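(* Let $K$ be a field of characteristic $\ell \geq 0$, and let $\phi \in K(z)$ be bicritical of degree $d \geq 2$ with critical points $\gamma_1, \gamma_2 \in \mathbb{P}^1(\overline{K})$. Assume that $\ell = 0$ or $\ell > d$. (1) If $\phi(\gamma_1) = \gamma_1$ and $\phi(\gamma_2) = \gamma_2$, then $\phi$ is conjugate over $K(\gamma_1, \gamma_2)$ to $cz^d$ for some $c \in K \setminus \{0\}$. (2) If $\phi(\gamma_1) = \gamma_2$ and $\phi(\gamma_2) = \gamma_1$, then $\phi$ is conjugate over $K(\gamma_1, \gamma_2)$ to $c/z^d$ for some $c \in K \setminus \{0\}$. (3) Otherwise, $\phi$ is conjugate over $K(\gamma_1, \gamma_2)$ to $$\frac{z^d + a}{z^d + b}$$ for some $a, b \in K(\gamma_1, \gamma_2)$ with $a \neq b$. Moreover, if two maps $(z^d + a)/(z^d + b)$ and $(z^d + a_1)/(z^d + b_1)$ in $\overline{K}(z)$ (with $a\ne b$ and $a_1\neq b_1$) are conjugate over $\overline{K}$, then the conjugacy is either by $\mu(z) = z$ or by $\mu(z) = (a/b)/z$. In the latter case we have $a_1 = a^d/b^{d+1}$ and $b_1 = a^{d-1}/b^d$.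
   Context: $\overline{K}$ is a fixed algebraic closure of $K$. Write $\phi = p/q$ with $p,q\in K[z]$ having no common root in $\overline K$. For $\alpha\in\overline K$ the ramification index $e_\alpha(\phi)$ is the order of vanishing at $z=\alpha$ of $p(z)q(\alpha)-q(z)p(\alpha)$; and $e_\infty(\phi)=e_0(\psi)$ where $\psi(z)=1/\phi(1/z)$. A point $\alpha\in\mathbb{P}^1(\overline K)$ is a critical point of $\phi$ if $e_\alpha(\phi)>1$. The map $\phi$ is bicritical if it has precisely two (distinct) critical points $\gamma_1,\gamma_2$ in $\mathbb{P}^1(\overline K)$. By convention $K(\infty)=K$. For a field $L$ with $K\subseteq L\subseteq \overline K$, "$\phi$ is conjugate over $L$ to $\psi$" means $\psi=\mu\circ\phi\circ\mu^{-1}$ for some $\mu\in \mathrm{PGL}_2(L)$, and then the conjugacy is said to be by $\mu$.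
   Formalization: In (1) and (2), c is taken in K(γ1,γ2)\{0} instead of K\{0}; the printed claim fails e.g. for K = Q, φ = -2(z^2-z-1)/(z^2+4z-1), whose critical points ±i are swapped. If γ1, γ2 are K-rational, it is the printed claim. *)

theory Defs
  imports "HOL-Computational_Algebra.Computational_Algebra"
begin

section \<open>Subfields of an algebraic closure\<close>

text \<open>
  The algebraic closure is an algebraically closed field type \<open>'a\<close>, and the base field and the
  intermediate fields are subsets of it.
\<close>

definition is_subfield :: "'a::field set \<Rightarrow> bool" where
  "is_subfield F \<longleftrightarrow>
     0 \<in> F \<and> 1 \<in> F \<and>
     (\<forall>x\<in>F. \<forall>y\<in>F. x + y \<in> F) \<and> (\<forall>x\<in>F. - x \<in> F) \<and>
     (\<forall>x\<in>F. \<forall>y\<in>F. x * y \<in> F) \<and> (\<forall>x\<in>F. inverse x \<in> F)"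

definition polys_over :: "'a::field set \<Rightarrow> 'a poly set" where
  "polys_over F = {p. \<forall>i. coeff p i \<in> F}"

definition closure_algebraic_over :: "'a::alg_closed_field set \<Rightarrow> bool" where
  "closure_algebraic_over K \<longleftrightarrow> (\<forall>x. \<exists>p\<in>polys_over K. p \<noteq> 0 \<and> poly p x = 0)"

section \<open>The projective line\<close>

datatype 'a proj_line = Fin 'a | Infty

text \<open>
  \<open>adjoin K S\<close> is the field generated by \<open>K\<close> and the finite points in \<open>S\<close>; the point at infinity
  contributes nothing, which is the convention \<open>K(\<infinity>) = K\<close>.
\<close>

definition adjoin :: "'a::field set \<Rightarrow> 'a proj_line set \<Rightarrow> 'a set" where
  "adjoin K S = \<Inter>{F. is_subfield F \<and> K \<subseteq> F \<and> {x. Fin x \<in> S} \<subseteq> F}"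

section \<open>Rational functions\<close>

type_synonym 'a ratfun = "'a poly fract"

definition rf_const :: "'a::field \<Rightarrow> 'a ratfun" where
  "rf_const c = to_fract [:c:]"

definition rf_z :: "'a::field ratfun" where
  "rf_z = to_fract [:0, 1:]"

definition ratfuns_over :: "'a::field set \<Rightarrow> 'a ratfun set" where
  "ratfuns_over K = {Fraction_Field.Fract p q | p q. p \<in> polys_over K \<and> q \<in> polys_over K \<and> q \<noteq> 0}"

text \<open>
  A pair as in the next definition always exists and is unique up to a common nonzero constant
  factor; none of the notions below depends on the choice.  In particular, for a function in
  \<open>K(z)\<close> it makes no difference that the chosen pair may have coefficients outside \<open>K\<close>.
\<close>

definition lowest_terms :: "'a::alg_closed_field ratfun \<Rightarrow> 'a poly \<times> 'a poly" where
  "lowest_terms f = (SOME (p, q). q \<noteq> 0 \<and> f = Fraction_Field.Fract p q \<and>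
                       (\<forall>x. \<not> (poly p x = 0 \<and> poly q x = 0)))"

definition rf_num :: "'a::alg_closed_field ratfun \<Rightarrow> 'a poly" where
  "rf_num f = fst (lowest_terms f)"

definition rf_den :: "'a::alg_closed_field ratfun \<Rightarrow> 'a poly" where
  "rf_den f = snd (lowest_terms f)"

definition rf_degree :: "'a::alg_closed_field ratfun \<Rightarrow> nat" where
  "rf_degree f = max (degree (rf_num f)) (degree (rf_den f))"

fun rf_eval :: "'a::alg_closed_field ratfun \<Rightarrow> 'a proj_line \<Rightarrow> 'a proj_line" where
  "rf_eval f (Fin x) =
     (if poly (rf_den f) x = 0 then Infty else Fin (poly (rf_num f) x / poly (rf_den f) x))"
| "rf_eval f Infty =
     (let d = rf_degree f
      in if coeff (rf_den f) d = 0 then Infty else Fin (coeff (rf_num f) d / coeff (rf_den f) d))"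

text \<open>
  \<open>rf_comp f g\<close> is the composite \<open>f \<circ> g\<close>: numerator and denominator of \<open>f\<close> are evaluated at \<open>g\<close>
  inside the field of rational functions.  The denominator vanishes only if \<open>g\<close> is a constant
  that is a pole of \<open>f\<close> (the value is then \<open>0\<close> by the convention for division).
\<close>

definition rf_comp :: "'a::alg_closed_field ratfun \<Rightarrow> 'a ratfun \<Rightarrow> 'a ratfun" where
  "rf_comp f g = poly (map_poly rf_const (rf_num f)) g / poly (map_poly rf_const (rf_den f)) g"

section \<open>Ramification\<close>

text \<open>
  For constant \<open>f\<close> the polynomial below is \<open>0\<close> and the order is not meaningful; the notion is only
  applied to functions of degree at least 2.
\<close>

definition ram_fin :: "'a::alg_closed_field ratfun \<Rightarrow> 'a \<Rightarrow> nat" where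
  "ram_fin f \<alpha> =
     order \<alpha> (smult (poly (rf_den f) \<alpha>) (rf_num f) - smult (poly (rf_num f) \<alpha>) (rf_den f))"

fun ram_index :: "'a::alg_closed_field ratfun \<Rightarrow> 'a proj_line \<Rightarrow> nat" where
  "ram_index f (Fin \<alpha>) = ram_fin f \<alpha>"
| "ram_index f Infty = ram_fin (1 / rf_comp f (1 / rf_z)) 0"

definition critical_points :: "'a::alg_closed_field ratfun \<Rightarrow> 'a proj_line set" where
  "critical_points f = {\<alpha>. ram_index f \<alpha> > 1}"

definition bicritical :: "'a::alg_closed_field ratfun \<Rightarrow> bool" where
  "bicritical f \<longleftrightarrow> card (critical_points f) = 2"

section \<open>Conjugation by fractional linear maps\<close>

text \<open>The group \<open>PGL\<^sub>2(L)\<close>, with a class of matrices identified with its fractional linear map.\<close>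

definition PGL2 :: "'a::field set \<Rightarrow> 'a ratfun set" where
  "PGL2 L = {Fraction_Field.Fract [:b, a:] [:e, c:] | a b c e.
               a \<in> L \<and> b \<in> L \<and> c \<in> L \<and> e \<in> L \<and> a * e - b * c \<noteq> 0}"

definition mobius_inv :: "'a::alg_closed_field ratfun \<Rightarrow> 'a ratfun" where
  "mobius_inv \<mu> = (THE \<nu>. \<nu> \<in> PGL2 UNIV \<and> rf_comp \<mu> \<nu> = rf_z \<and> rf_comp \<nu> \<mu> = rf_z)"

definition conjugate_by :: "'a::alg_closed_field ratfun \<Rightarrow> 'a ratfun \<Rightarrow> 'a ratfun \<Rightarrow> bool" where
  "conjugate_by \<mu> f g \<longleftrightarrow> g = rf_comp (rf_comp \<mu> f) (mobius_inv \<mu>)"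

definition conjugate_over :: "'a::alg_closed_field set \<Rightarrow> 'a ratfun \<Rightarrow> 'a ratfun \<Rightarrow> bool" where
  "conjugate_over L f g \<longleftrightarrow> (\<exists>\<mu>\<in>PGL2 L. conjugate_by \<mu> f g)"

end

theory Submission
  imports Defs
begin

text \<open>
  A bicritical map is totally ramified at both critical points, and a map that is totally ramified
  at two points is, up to fractional linear maps on both sides, the power map.  Everything else is
  bookkeeping about where those two points go.
  
  \<^bold>\<open>Total ramification.\<close>  Write \<open>\<phi> = p / q\<close> in lowest terms.  The derivative of \<open>\<phi>\<close> has numerator
  \<open>W = p' q - p q'\<close>, of degree at most \<open>2 d - 2\<close>.  Because the characteristic is \<open>0\<close> or larger than
  \<open>d\<close>, ramification is tame, so \<open>W\<close> vanishes at a finite point to order one less than the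
  ramification index (\<open>wronskian_order\<close>), and its degree defect \<open>2 d - 2 - degree W\<close> is bounded in
  the same way by the index at infinity (\<open>wronskian_degree\<close>).  Counting roots, the two
  numbers \<open>e - 1 \<le> d - 1\<close> must add up to at least \<open>2 d - 2\<close>, which forces both indices to be \<open>d\<close>
  (\<open>bicritical_totally_ramified\<close>).  This is the Riemann--Hurwitz formula for the projective line.
  
  \<^bold>\<open>Normal form.\<close>  Total ramification at \<open>\<gamma>\<close> says that the fibre polynomial
  \<open>q(\<gamma>) p - p(\<gamma>) q\<close> is a constant times \<open>l\<^sup>d\<close>, where \<open>l\<close> is the linear form that vanishes at \<open>\<gamma>\<close>.
  Taking the quotient of the two such identities shows that \<open>\<phi>\<close> followed by a fractional linear map is
  a constant times the \<open>d\<close>-th power of \<open>\<mu> = l\<^sub>1 / l\<^sub>2\<close>.  Hence \<open>\<mu>\<close> conjugates \<open>\<phi>\<close> to a fractional linear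
  function of \<open>z\<^sup>d\<close>, whose four coefficients are, up to nonzero factors, the numbers that vanish
  exactly if \<open>\<phi>\<close> sends one critical point to a given one (\<open>conjugate_coord_mobius_iff\<close>,
  \<open>incidence_eq_0_iff\<close>).  The three cases of the classification are the possible positions of zeros among these
  coefficients; in the last case a rescaling of \<open>\<mu>\<close> makes the two coefficients of \<open>z\<^sup>d\<close> equal.
  All the quantities lie in \<open>K(\<gamma>\<^sub>1, \<gamma>\<^sub>2)\<close> because lowest terms can be found over \<open>K\<close>
  (\<open>ratfuns_over_lowest_terms\<close>).
  
  \<^bold>\<open>Uniqueness.\<close>  A conjugacy \<open>\<mu> = N / D\<close> between two maps \<open>(z\<^sup>d + a) / (z\<^sup>d + b)\<close> gives an identity
  \<open>N\<^sup>d X = D\<^sup>d Y\<close> with \<open>X\<close> and \<open>Y\<close> of the form \<open>m z\<^sup>d + n\<close>.  Such binomials have no multiple root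
  besides \<open>0\<close>, so \<open>\<mu>\<close> has its zero and its pole in \<open>{0, \<infinity>}\<close> and is \<open>t z\<close> or \<open>t / z\<close>
  (\<open>conjugacy_monomial\<close>).  Comparing coefficients then determines \<open>t\<close> and the parameters.
  
  Composition and conjugation are defined through chosen lowest terms and a chosen inverse, so they are first
  turned into identities in the field of rational functions: substitution of a nonconstant function
  is a field homomorphism, and conjugacy by \<open>\<mu>\<close> becomes \<open>g \<circ> \<mu> = \<mu> \<circ> f\<close> (\<open>conjugate_by_iff\<close>).
\<close>

section \<open>Constants and substitution into polynomials\<close>

lemma rf_const_hom [simp]:
  "rf_const (0::'a::field) = 0" "rf_const (1::'a) = 1"
  "rf_const (x + y) = rf_const x + rf_const y"
  "rf_const (x - y) = rf_const x - rf_const y"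
  "rf_const (- x) = - rf_const x"
  "rf_const (x * y) = rf_const x * rf_const y"
  by (simp_all add: rf_const_def
        flip: one_pCons to_fract_add to_fract_diff to_fract_mult to_fract_uminus)

lemma rf_const_eq_iff [simp]: "rf_const x = rf_const y \<longleftrightarrow> x = y"
  by (simp add: rf_const_def)

lemma rf_const_eq_0_iff [simp]: "rf_const x = 0 \<longleftrightarrow> x = 0"
  by (simp add: rf_const_def)

lemma rf_const_inverse [simp]: "rf_const (inverse x) = inverse (rf_const x)"
proof (cases "x = 0")
  case False
  then have "rf_const x * rf_const (inverse x) = 1"
    by (simp flip: rf_const_hom)
  then show ?thesis
    by (metis inverse_unique)
qed simp

lemma rf_const_divide [simp]: "rf_const (x / y) = rf_const x / rf_const y"
  by (simp add: field_class.field_divide_inverse)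

lemma rf_const_power [simp]: "rf_const (x ^ n) = rf_const x ^ n"
  by (induction n) simp_all

lemma to_fract_power: "to_fract (p ^ n) = to_fract p ^ n"
  by (induction n) simp_all

lemma to_fract_const: "to_fract [:c:] = rf_const c"
  by (simp add: rf_const_def)

lemma to_fract_smult: "to_fract (smult c p) = rf_const c * to_fract p"
  by (metis mult_pCons_left add_0_right pCons_0_0 mult_zero_left to_fract_const to_fract_mult)

lemma to_fract_linear: "to_fract [:b, a:] = rf_const a * rf_z + rf_const b"
proof -
  have "[:b, a:] = [:a:] * [:0, 1:] + [:b:]"
    by simp
  then show ?thesis
    unfolding rf_const_def rf_z_def by (simp only: to_fract_mult to_fract_add)
qed

lemma to_fract_monom: "to_fract (monom c n) = rf_const c * rf_z ^ n"
proof -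
  have "monom c n = [:c:] * [:0, 1:] ^ n"
    by (simp add: monom_altdef)
  then show ?thesis
    unfolding rf_const_def rf_z_def by (simp only: to_fract_mult to_fract_power)
qed

definition rf_ev :: "'a::field ratfun \<Rightarrow> 'a poly \<Rightarrow> 'a ratfun" where
  "rf_ev h p = poly (map_poly rf_const p) h"

lemma rf_ev_pCons [simp]: "rf_ev h (pCons a p) = rf_const a + h * rf_ev h p"
  by (simp add: rf_ev_def map_poly_pCons)

lemma rf_ev_0 [simp]: "rf_ev h 0 = 0"
  by (simp add: rf_ev_def)

lemma rf_ev_1 [simp]: "rf_ev h 1 = 1"
  by (simp add: one_pCons)

lemma rf_ev_add [simp]: "rf_ev h (p + q) = rf_ev h p + rf_ev h q"
  by (induction p q rule: poly_induct2) (simp_all add: algebra_simps)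

lemma rf_ev_smult [simp]: "rf_ev h (smult c p) = rf_const c * rf_ev h p"
  by (induction p) (simp_all add: algebra_simps)

lemma rf_ev_mult [simp]: "rf_ev h (p * q) = rf_ev h p * rf_ev h q"
  by (induction p) (simp_all add: algebra_simps)

lemma rf_ev_monom [simp]: "rf_ev h (monom c n) = rf_const c * h ^ n"
  by (induction n) (simp_all add: monom_0 monom_Suc)

lemma rf_ev_altdef:
  assumes "degree p \<le> n"
  shows "rf_ev h p = (\<Sum>i\<le>n. rf_const (coeff p i) * h ^ i)"
proof -
  have "p = (\<Sum>i\<le>n. monom (coeff p i) i)"
    using assms by (rule poly_as_sum_of_monoms'[symmetric])
  moreover have "rf_ev h (sum f A) = (\<Sum>i\<in>A. rf_ev h (f i))" if "finite A" for f and A :: "nat set"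
    using that by induction simp_all
  ultimately show ?thesis
    by (metis (no_types, lifting) finite_atMost rf_ev_monom sum.cong)
qed

lemma to_fract_eq_rf_ev: "to_fract p = rf_ev rf_z p"
proof (induction p)
  case (pCons a p)
  have "pCons a p = [:a:] + [:0, 1:] * p"
    by simp
  then have "to_fract (pCons a p) = rf_const a + rf_z * to_fract p"
    unfolding rf_const_def rf_z_def by (simp only: to_fract_mult to_fract_add)
  then show ?case
    by (simp add: pCons.IH)
qed simp

definition nonconst :: "'a::field ratfun \<Rightarrow> bool" where
  "nonconst h \<longleftrightarrow> (\<forall>c. h \<noteq> rf_const c)"

text \<open>
  A nonconstant rational function is transcendental over the constants: since the constant field
  is algebraically closed, an algebraic relation splits into linear factors, one of which would
  have to vanish.
\<close>

lemma rf_ev_eq_0_iff: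
  fixes h :: "'a::alg_closed_field ratfun"
  assumes "nonconst h"
  shows "rf_ev h p = 0 \<longleftrightarrow> p = 0"
proof
  show "p = 0" if "rf_ev h p = 0"
    using that
  proof (induction "degree p" arbitrary: p rule: less_induct)
    case less
    show ?case
    proof (cases "degree p = 0")
      case True
      then obtain c where "p = [:c:]"
        by (meson degree_eq_zeroE)
      then show ?thesis
        using less.prems by simp
    next
      case False
      then obtain r where "poly p r = 0"
        using alg_closed_imp_poly_has_root by blast
      then obtain q where p: "p = [:-r, 1:] * q"
        using poly_eq_0_iff_dvd by (metis dvdE)
      then have "q \<noteq> 0"
        using False by auto
      then have "degree q < degree p"
        unfolding p by (subst degree_mult_eq) auto
      moreover have "(h - rf_const r) * rf_ev h q = 0"
        using less.prems unfolding p rf_ev_mult by simp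
      then have "rf_ev h q = 0"
        using assms by (simp add: nonconst_def)
      ultimately show ?thesis
        using less.hyps \<open>q \<noteq> 0\<close> by blast
    qed
  qed
qed simp

section \<open>Lowest terms over a subfield\<close>

context
  fixes K :: "'a::field set"
  assumes K: "is_subfield K"
begin

lemma subfield_closed [simp]:
  shows "0 \<in> K" "1 \<in> K"
    and "x \<in> K \<Longrightarrow> y \<in> K \<Longrightarrow> x + y \<in> K"
    and "x \<in> K \<Longrightarrow> - x \<in> K"
    and "x \<in> K \<Longrightarrow> y \<in> K \<Longrightarrow> x * y \<in> K"
    and "x \<in> K \<Longrightarrow> inverse x \<in> K"
  using K by (auto simp: is_subfield_def)

lemma subfield_diff [simp]: "x \<in> K \<Longrightarrow> y \<in> K \<Longrightarrow> x - y \<in> K"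
  by (metis add_uminus_conv_diff subfield_closed(3,4))

lemma subfield_divide [simp]: "x \<in> K \<Longrightarrow> y \<in> K \<Longrightarrow> x / y \<in> K"
  by (simp add: field_class.field_divide_inverse)

lemma subfield_power [simp]: "x \<in> K \<Longrightarrow> x ^ n \<in> K"
  by (induction n) simp_all

lemma subfield_sum [simp]: "(\<And>i. i \<in> A \<Longrightarrow> f i \<in> K) \<Longrightarrow> sum f A \<in> K"
  by (induction A rule: infinite_finite_induct) simp_all

lemma polys_over_closed:
  shows "0 \<in> polys_over K" "1 \<in> polys_over K"
    and "p \<in> polys_over K \<Longrightarrow> q \<in> polys_over K \<Longrightarrow> p + q \<in> polys_over K"
    and "p \<in> polys_over K \<Longrightarrow> q \<in> polys_over K \<Longrightarrow> p - q \<in> polys_over K"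
    and "p \<in> polys_over K \<Longrightarrow> q \<in> polys_over K \<Longrightarrow> p * q \<in> polys_over K"
    and "c \<in> K \<Longrightarrow> monom c n \<in> polys_over K"
  by (auto simp: polys_over_def coeff_mult)

lemma poly_in_subfield: "p \<in> polys_over K \<Longrightarrow> x \<in> K \<Longrightarrow> poly p x \<in> K"
  by (auto simp: polys_over_def poly_altdef)

lemma poly_division_over_subfield:
  assumes "p \<in> polys_over K" "q \<in> polys_over K" "q \<noteq> 0"
  shows "\<exists>s\<in>polys_over K. \<exists>r\<in>polys_over K. p = s * q + r \<and> (r = 0 \<or> degree r < degree q)"
  using assms(1)
proof (induction "degree p" arbitrary: p rule: less_induct)
  case less
  show ?case
  proof (cases "p = 0 \<or> degree p < degree q")
    case True
    then show ?thesis
      using less.prems by (intro bexI[of _ 0] bexI[of _ p]) (auto simp: polys_over_closed)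
  next
    case False
    define m where "m = monom (lead_coeff p / lead_coeff q) (degree p - degree q)"
    have m: "m \<in> polys_over K"
      using less.prems assms(2) unfolding m_def
      by (intro polys_over_closed) (auto simp: polys_over_def)
    have "m \<noteq> 0"
      using False assms(3) by (simp add: m_def)
    have deg: "degree (m * q) = degree p"
      using False assms(3) \<open>m \<noteq> 0\<close> by (simp add: degree_mult_eq) (simp add: m_def degree_monom_eq)
    have "lead_coeff m * lead_coeff q = lead_coeff p"
      using assms(3) \<open>m \<noteq> 0\<close> False unfolding m_def by (subst lead_coeff_monom) auto
    then have lead: "lead_coeff (m * q) = lead_coeff p"
      by (simp add: lead_coeff_mult)
    have r: "p - m * q \<in> polys_over K"
      using less.prems assms m by (intro polys_over_closed)
    show ?thesis
    proof (cases "p - m * q = 0")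
      case True
      then show ?thesis
        using m by (intro bexI[of _ m] bexI[of _ 0]) (auto simp: polys_over_closed)
    next
      case nz: False
      have "degree (p - m * q) < degree p"
      proof -
        have "degree (p - m * q) \<le> degree p"
          using deg by (intro degree_diff_le) auto
        moreover have "coeff (p - m * q) (degree p) = 0"
          using lead deg by simp
        ultimately show ?thesis
          using nz by (metis le_neq_implies_less leading_coeff_0_iff)
      qed
      then obtain s r where "s \<in> polys_over K" "r \<in> polys_over K"
          "p - m * q = s * q + r" "r = 0 \<or> degree r < degree q"
        using less.hyps r by blast
      then show ?thesis
        using m by (intro bexI[of _ "s + m"] bexI[of _ r])
          (auto simp: polys_over_closed algebra_simps)
    qed
  qed
qed

text \<open>
  The Euclidean algorithm stays inside the subfield.  The result is phrased with the two cofactors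
  \<open>p'\<close> and \<open>q'\<close> rather than a greatest common divisor because the identity \<open>u p' + v q' = 1\<close>
  excludes common roots in the whole algebraically closed field.
\<close>

lemma bezout_over_subfield:
  assumes "p \<in> polys_over K" "q \<in> polys_over K" "p \<noteq> 0 \<or> q \<noteq> 0"
  shows "\<exists>g\<in>polys_over K. \<exists>p'\<in>polys_over K. \<exists>q'\<in>polys_over K. \<exists>u\<in>polys_over K. \<exists>v\<in>polys_over K.
           p = g * p' \<and> q = g * q' \<and> u * p' + v * q' = 1"
  using assms
proof (induction "if q = 0 then 0 else Suc (degree q)" arbitrary: p q rule: less_induct)
  case less
  show ?case
  proof (cases "q = 0")
    case True
    then show ?thesis
      using less.prems
      by (intro bexI[of _ p] bexI[of _ 1] bexI[of _ 0]) (auto simp: polys_over_closed)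
  next
    case False
    then obtain s r where sr: "s \<in> polys_over K" "r \<in> polys_over K"
        "p = s * q + r" "r = 0 \<or> degree r < degree q"
      using poly_division_over_subfield less.prems by metis
    have "(if r = 0 then 0 else Suc (degree r)) < (if q = 0 then 0 else Suc (degree q))"
      using sr False by auto
    then obtain g q' r' u v where *: "g \<in> polys_over K" "q' \<in> polys_over K" "r' \<in> polys_over K"
        "u \<in> polys_over K" "v \<in> polys_over K" "q = g * q'" "r = g * r'" "u * q' + v * r' = 1"
      using less.hyps[OF _ less.prems(2) sr(2)] False by metis
    have "p = g * (s * q' + r')"
      using sr(3) * by (simp add: algebra_simps)
    moreover have "v * (s * q' + r') + (u - v * s) * q' = 1"
      using *(8) by (simp add: algebra_simps)
    moreover have "s * q' + r' \<in> polys_over K" "u - v * s \<in> polys_over K"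
      using * sr by (simp_all add: polys_over_closed)
    ultimately show ?thesis
      using *(1,2,5,6) by blast
  qed
qed

end

lemma is_subfield_UNIV: "is_subfield UNIV"
  by (simp add: is_subfield_def)

definition no_common_root :: "'a::comm_semiring_0 poly \<Rightarrow> 'a poly \<Rightarrow> bool" where
  "no_common_root p q \<longleftrightarrow> (\<forall>x. \<not> (poly p x = 0 \<and> poly q x = 0))"

lemma ratfuns_over_lowest_terms:
  fixes K :: "'a::alg_closed_field set"
  assumes "is_subfield K" "f \<in> ratfuns_over K"
  obtains p q where "p \<in> polys_over K" "q \<in> polys_over K" "q \<noteq> 0"
    "f = Fraction_Field.Fract p q" "no_common_root p q"
proof -
  obtain P Q where PQ: "P \<in> polys_over K" "Q \<in> polys_over K" "Q \<noteq> 0" "f = Fraction_Field.Fract P Q"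
    using assms(2) by (auto simp: ratfuns_over_def)
  then obtain g p q u v where *: "p \<in> polys_over K" "q \<in> polys_over K" "P = g * p" "Q = g * q"
      "u * p + v * q = 1"
    using bezout_over_subfield[OF assms(1), of P Q] by blast
  have "no_common_root p q"
    unfolding no_common_root_def
  proof (intro allI notI)
    fix x assume "poly p x = 0 \<and> poly q x = 0"
    then have "poly (u * p + v * q) x = 0"
      by simp
    then show False
      by (simp add: *(5))
  qed
  moreover have "q \<noteq> 0" "f = Fraction_Field.Fract p q"
    using PQ * by (auto simp: eq_fract)
  ultimately show ?thesis
    using that * by blast
qed

text \<open>
  With \<open>u p\<^sub>0 + v q\<^sub>0 = 1\<close>, the proportionality factor between the two pairs is the polynomial
  \<open>w = u p' + v q'\<close>; a root of \<open>w\<close> would be a common root of the second pair, so \<open>w\<close> is constant.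
\<close>

lemma lowest_terms_unique:
  fixes p q p' q' :: "'a::alg_closed_field poly"
  assumes "no_common_root p q" "no_common_root p' q'" "p' * q = p * q'"
  obtains k where "k \<noteq> 0" "p' = smult k p" "q' = smult k q"
proof -
  have "p \<noteq> 0 \<or> q \<noteq> 0"
    using assms(1) by (auto simp: no_common_root_def)
  then obtain g p0 q0 u v where *: "p = g * p0" "q = g * q0" "u * p0 + v * q0 = 1"
    using bezout_over_subfield[OF is_subfield_UNIV, of p q] by (auto simp: polys_over_def)
  have "degree g = 0"
  proof (rule ccontr)
    assume "degree g \<noteq> 0"
    then obtain x where "poly g x = 0"
      using alg_closed_imp_poly_has_root by blast
    then show False
      using assms(1) * by (auto simp: no_common_root_def)
  qed
  then obtain c where c: "g = [:c:]"
    by (meson degree_eq_zeroE)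
  with * \<open>p \<noteq> 0 \<or> q \<noteq> 0\<close> have "c \<noteq> 0"
    by auto
  have "smult c (p' * q0 - p0 * q') = 0"
    using assms(3) unfolding * c by (simp add: smult_diff_right)
  then have eq: "p' * q0 = p0 * q'"
    using \<open>c \<noteq> 0\<close> by simp
  define w where "w = u * p' + v * q'"
  have p': "p' = w * p0" and q': "q' = w * q0"
  proof -
    have "p' = p' * (u * p0 + v * q0)" "q' = q' * (u * p0 + v * q0)"
      by (simp_all add: *(3))
    moreover have "p' * (u * p0 + v * q0) = w * p0" "q' * (u * p0 + v * q0) = w * q0"
      unfolding w_def using eq by algebra+
    ultimately show "p' = w * p0" "q' = w * q0"
      by simp_all
  qed
  have "degree w = 0"
  proof (rule ccontr)
    assume "degree w \<noteq> 0"
    then obtain x where "poly w x = 0"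
      using alg_closed_imp_poly_has_root by blast
    then show False
      using assms(2) p' q' by (auto simp: no_common_root_def)
  qed
  then obtain e where e: "w = [:e:]"
    by (meson degree_eq_zeroE)
  have "e \<noteq> 0"
    using assms(2) p' q' e by (auto simp: no_common_root_def)
  show ?thesis
    using \<open>e \<noteq> 0\<close> \<open>c \<noteq> 0\<close> by (intro that[of "e / c"]) (simp_all add: p' q' e * c)
qed

lemma rf_num_den:
  fixes f :: "'a::alg_closed_field ratfun"
  shows "rf_den f \<noteq> 0" "f = Fraction_Field.Fract (rf_num f) (rf_den f)"
    "no_common_root (rf_num f) (rf_den f)"
proof -
  have "f \<in> ratfuns_over UNIV"
    by (cases f) (auto simp: ratfuns_over_def polys_over_def)
  then obtain p q where "q \<noteq> 0" "f = Fraction_Field.Fract p q" "no_common_root p q"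
    using ratfuns_over_lowest_terms is_subfield_UNIV by metis
  then have ex: "case (p, q) of (p, q) \<Rightarrow> q \<noteq> 0 \<and> f = Fraction_Field.Fract p q \<and>
                       (\<forall>x. \<not> (poly p x = 0 \<and> poly q x = 0))"
    by (simp add: no_common_root_def)
  have "case lowest_terms f of (p, q) \<Rightarrow> q \<noteq> 0 \<and> f = Fraction_Field.Fract p q \<and>
                       (\<forall>x. \<not> (poly p x = 0 \<and> poly q x = 0))"
    unfolding lowest_terms_def using ex by (rule someI)
  then show "rf_den f \<noteq> 0" "f = Fraction_Field.Fract (rf_num f) (rf_den f)"
    "no_common_root (rf_num f) (rf_den f)"
    by (simp_all add: rf_num_def rf_den_def no_common_root_def case_prod_beta)
qed

lemma rf_num_den_Fract:
  fixes p q :: "'a::alg_closed_field poly"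
  assumes "q \<noteq> 0" "no_common_root p q"
  obtains k where "k \<noteq> 0" "rf_num (Fraction_Field.Fract p q) = smult k p"
    "rf_den (Fraction_Field.Fract p q) = smult k q"
proof -
  let ?f = "Fraction_Field.Fract p q"
  have "rf_num ?f * q = p * rf_den ?f"
    using rf_num_den(1,2)[of ?f] assms(1) by (simp add: eq_fract)
  then show ?thesis
    using lowest_terms_unique[OF assms(2) rf_num_den(3)[of ?f]] that by blast
qed

section \<open>Composition and conjugation\<close>

text \<open>
  Composition may be computed from any representing fraction, in lowest terms or not.  That makes
  substitution of a nonconstant \<open>h\<close> a field homomorphism, as the following simplification
  rules record.
\<close>

lemma rf_comp_Fract:
  fixes h :: "'a::alg_closed_field ratfun"
  assumes "nonconst h" "q \<noteq> 0"
  shows "rf_comp (Fraction_Field.Fract p q) h = rf_ev h p / rf_ev h q"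
proof -
  let ?f = "Fraction_Field.Fract p q"
  have "rf_num ?f * q = p * rf_den ?f"
    using rf_num_den(1,2)[of ?f] assms(2) by (simp add: eq_fract)
  then have "rf_ev h (rf_num ?f) * rf_ev h q = rf_ev h p * rf_ev h (rf_den ?f)"
    by (metis rf_ev_mult)
  then show ?thesis
    using assms rf_num_den(1)[of ?f]
    by (simp add: rf_comp_def rf_ev_eq_0_iff frac_eq_eq flip: rf_ev_def)
qed

lemma rf_comp_to_fract:
  fixes h :: "'a::alg_closed_field ratfun"
  assumes "nonconst h"
  shows "rf_comp (to_fract p) h = rf_ev h p"
  using rf_comp_Fract[OF assms, of 1 p] by (simp add: to_fract_def)

context
  fixes h :: "'a::alg_closed_field ratfun"
  assumes h: "nonconst h"
begin

lemma rf_comp_const [simp]: "rf_comp (rf_const c) h = rf_const c"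
  using rf_comp_to_fract[OF h, of "[:c:]"] by (simp add: rf_const_def)

lemma rf_comp_0 [simp]: "rf_comp 0 h = 0" and rf_comp_1 [simp]: "rf_comp 1 h = 1"
  using rf_comp_const[of 0] rf_comp_const[of 1] by simp_all

lemma rf_comp_z [simp]: "rf_comp rf_z h = h"
  using rf_comp_to_fract[OF h, of "[:0, 1:]"] by (simp add: rf_z_def)

lemma rf_comp_add [simp]: "rf_comp (f + g) h = rf_comp f h + rf_comp g h"
  by (cases f, cases g) (simp add: rf_comp_Fract[OF h] rf_ev_eq_0_iff[OF h] add_frac_eq)

lemma rf_comp_mult [simp]: "rf_comp (f * g) h = rf_comp f h * rf_comp g h"
  by (cases f, cases g) (simp add: rf_comp_Fract[OF h])

lemma rf_comp_divide [simp]: "rf_comp (f / g) h = rf_comp f h / rf_comp g h"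
proof (cases "g = 0")
  case False
  obtain p q where g: "g = Fraction_Field.Fract p q" "q \<noteq> 0"
    by (cases g)
  then have "p \<noteq> 0"
    using False by (auto simp: fract_collapse)
  then have nz: "rf_comp g h \<noteq> 0"
    using g by (simp add: rf_comp_Fract[OF h] rf_ev_eq_0_iff[OF h])
  have "rf_comp (f / g) h * rf_comp g h = rf_comp f h"
    using False by (simp flip: rf_comp_mult)
  then show ?thesis
    using nz by (simp add: field_simps)
qed simp

lemma rf_comp_power [simp]: "rf_comp (f ^ n) h = rf_comp f h ^ n"
  by (induction n) simp_all

lemma rf_comp_diff [simp]: "rf_comp (f - g) h = rf_comp f h - rf_comp g h"
  using rf_comp_add[of "f - g" g] by (simp add: algebra_simps del: rf_comp_add)

lemma rf_comp_minus [simp]: "rf_comp (- f) h = - rf_comp f h"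
  using rf_comp_diff[of 0 f] by simp

lemma rf_comp_rf_ev: "rf_comp (rf_ev g p) h = rf_ev (rf_comp g h) p"
  by (induction p) simp_all

lemma rf_comp_eq_0_iff: "rf_comp f h = 0 \<longleftrightarrow> f = 0"
proof
  assume "rf_comp f h = 0"
  then have "rf_comp (f / f) h \<noteq> 1"
    unfolding rf_comp_divide by simp
  then show "f = 0"
    by (cases "f = 0") (simp_all del: rf_comp_divide)
qed simp

lemma nonconst_rf_comp:
  assumes "nonconst f"
  shows "nonconst (rf_comp f h)"
  unfolding nonconst_def
proof (intro allI notI)
  fix c assume "rf_comp f h = rf_const c"
  then have "rf_comp (f - rf_const c) h = 0"
    by simp
  then have "f = rf_const c"
    by (simp add: rf_comp_eq_0_iff del: rf_comp_diff)
  then show False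
    using assms by (simp add: nonconst_def)
qed

end

lemma rf_comp_z_right [simp]: "rf_comp f rf_z = f" for f :: "'a::alg_closed_field ratfun"
  using rf_num_den(1,2)[of f]
  by (simp add: rf_comp_def Fract_conv_to_fract to_fract_eq_rf_ev flip: rf_ev_def)

lemma rf_comp_assoc:
  fixes f g h :: "'a::alg_closed_field ratfun"
  assumes "nonconst g" "nonconst h"
  shows "rf_comp (rf_comp f g) h = rf_comp f (rf_comp g h)"
  by (simp add: rf_comp_def[of f] rf_comp_rf_ev[OF assms(2)] rf_comp_divide[OF assms(2)]
        flip: rf_ev_def)

lemma nonconst_z: "nonconst rf_z"
  by (simp add: nonconst_def rf_z_def rf_const_def)

lemma nonconst_power:
  fixes h :: "'a::alg_closed_field ratfun"
  assumes "nonconst h" "n > 0"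
  shows "nonconst (h ^ n)"
  unfolding nonconst_def
proof (intro allI notI)
  fix c assume "h ^ n = rf_const c"
  then have "rf_ev h (monom 1 n + [:- c:]) = 0"
    by simp
  then have "monom 1 n + [:- c:] = 0"
    using rf_ev_eq_0_iff[OF assms(1)] by blast
  then have "coeff (monom 1 n + [:- c:]) n = 0"
    by simp
  then show False
    using assms(2) by (simp add: coeff_pCons split: nat.splits)
qed

lemma linear_at_neq_0:
  fixes h :: "'a::alg_closed_field ratfun"
  assumes "nonconst h" "a \<noteq> 0 \<or> b \<noteq> 0"
  shows "rf_const a * h + rf_const b \<noteq> 0"
proof -
  have "rf_ev h [:b, a:] \<noteq> 0"
    using assms rf_ev_eq_0_iff[OF assms(1), of "[:b, a:]"] by auto
  then show ?thesis
    by (simp add: algebra_simps)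
qed

text \<open>
  The matrix with rows \<open>(a, b)\<close> and \<open>(c, e)\<close> acts on the whole function field rather than only on the
  coordinate \<open>rf_z\<close>, so that composing with an element of \<open>PGL2\<close> on the left is again an instance
  (\<open>rf_comp_mobius\<close>).
\<close>

definition mobius :: "'a::field \<Rightarrow> 'a \<Rightarrow> 'a \<Rightarrow> 'a \<Rightarrow> 'a ratfun \<Rightarrow> 'a ratfun" where
  "mobius a b c e h = (rf_const a * h + rf_const b) / (rf_const c * h + rf_const e)"

lemma PGL2_iff:
  "\<mu> \<in> PGL2 L \<longleftrightarrow> (\<exists>a\<in>L. \<exists>b\<in>L. \<exists>c\<in>L. \<exists>e\<in>L. a * e - b * c \<noteq> 0 \<and> \<mu> = mobius a b c e rf_z)"
  unfolding PGL2_def mobius_def by (auto simp: Fract_conv_to_fract to_fract_linear)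

lemma rf_comp_mobius:
  fixes g h :: "'a::alg_closed_field ratfun"
  assumes "nonconst h"
  shows "rf_comp (mobius a b c e g) h = mobius a b c e (rf_comp g h)"
  unfolding mobius_def by (simp add: assms)

lemma nonconst_mobius:
  fixes h :: "'a::alg_closed_field ratfun"
  assumes "nonconst h" "a * e - b * c \<noteq> 0"
  shows "nonconst (mobius a b c e h)"
  unfolding nonconst_def
proof (intro allI notI)
  fix r assume *: "mobius a b c e h = rf_const r"
  have "rf_const c * h + rf_const e \<noteq> 0"
    using assms by (intro linear_at_neq_0) auto
  with * have "rf_const (a - r * c) * h + rf_const (b - r * e) = 0"
    by (simp add: mobius_def field_simps)
  then have "a = r * c" "b = r * e"
    using linear_at_neq_0[OF assms(1), of "a - r * c" "b - r * e"] by auto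
  then show False
    using assms(2) by simp
qed

lemma mobius_mobius_inverse:
  fixes h :: "'a::alg_closed_field ratfun"
  assumes "nonconst h" "a * e - b * c \<noteq> 0"
  shows "mobius a b c e (mobius e (- b) (- c) a h) = h"
proof -
  let ?D = "rf_const (- c) * h + rf_const a"
  have D: "?D \<noteq> 0"
    using assms by (intro linear_at_neq_0) auto
  have det: "rf_const (a * e - b * c) \<noteq> 0"
    using assms(2) by (simp del: rf_const_hom)
  have "rf_const a * ((rf_const e * h + rf_const (- b)) / ?D) + rf_const b = rf_const (a * e - b * c) * h / ?D"
    using D by (simp add: field_simps)
  moreover have "rf_const c * ((rf_const e * h + rf_const (- b)) / ?D) + rf_const e = rf_const (a * e - b * c) / ?D"
    using D by (simp add: field_simps)
  ultimately show ?thesis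
    unfolding mobius_def using D det by (simp del: rf_const_hom)
qed

lemma mobius_inv_props:
  fixes \<mu> :: "'a::alg_closed_field ratfun"
  assumes "\<mu> \<in> PGL2 UNIV"
  shows "nonconst \<mu>" "nonconst (mobius_inv \<mu>)"
    "rf_comp \<mu> (mobius_inv \<mu>) = rf_z" "rf_comp (mobius_inv \<mu>) \<mu> = rf_z"
proof -
  obtain a b c e where det: "a * e - b * c \<noteq> 0" and \<mu>: "\<mu> = mobius a b c e rf_z"
    using assms by (auto simp: PGL2_iff)
  define \<nu> where "\<nu> = mobius e (- b) (- c) a rf_z"
  have det': "e * a - (- b) * (- c) \<noteq> 0"
    using det by (simp add: mult.commute)
  show nc: "nonconst \<mu>"
    using nonconst_mobius[OF nonconst_z det] by (simp add: \<mu>)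
  have nc': "nonconst \<nu>"
    using nonconst_mobius[OF nonconst_z det'] by (simp add: \<nu>_def)
  have "\<nu> \<in> PGL2 UNIV"
    unfolding PGL2_iff \<nu>_def using det' by blast
  moreover have "rf_comp \<mu> \<nu> = rf_z"
    using mobius_mobius_inverse[OF nonconst_z det] nc'
    by (simp add: \<mu> rf_comp_mobius) (simp add: \<nu>_def)
  moreover have "rf_comp \<nu> \<mu> = rf_z"
    using mobius_mobius_inverse[OF nonconst_z det'] nc
    by (simp add: \<nu>_def rf_comp_mobius) (simp add: \<mu>)
  ultimately have P: "\<nu> \<in> PGL2 UNIV \<and> rf_comp \<mu> \<nu> = rf_z \<and> rf_comp \<nu> \<mu> = rf_z"
    by blast
  have "mobius_inv \<mu> = \<nu>"
    unfolding mobius_inv_def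
  proof (rule the_equality, rule P, elim conjE)
    fix \<nu>' assume *: "\<nu>' \<in> PGL2 UNIV" "rf_comp \<mu> \<nu>' = rf_z" "rf_comp \<nu>' \<mu> = rf_z"
    have "\<nu>' = rf_comp \<nu>' (rf_comp \<mu> \<nu>)"
      using P by simp
    also have "\<dots> = rf_comp (rf_comp \<nu>' \<mu>) \<nu>"
      by (rule rf_comp_assoc[symmetric, OF nc nc'])
    finally show "\<nu>' = \<nu>"
      using * nc' by simp
  qed
  then show "nonconst (mobius_inv \<mu>)" "rf_comp \<mu> (mobius_inv \<mu>) = rf_z"
    "rf_comp (mobius_inv \<mu>) \<mu> = rf_z"
    using P nc' by simp_all
qed

text \<open>
  Multiplying by \<open>\<mu>\<close> on the right removes the inverse from the definition of conjugacy, and no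
  inverse has to be computed afterwards.
\<close>

lemma conjugate_by_iff:
  fixes \<mu> f g :: "'a::alg_closed_field ratfun"
  assumes "\<mu> \<in> PGL2 UNIV" "nonconst f"
  shows "conjugate_by \<mu> f g \<longleftrightarrow> rf_comp g \<mu> = rf_comp \<mu> f"
proof -
  note inv = mobius_inv_props[OF assms(1)]
  have nc: "nonconst (rf_comp \<mu> f)"
    using nonconst_rf_comp assms(2) inv(1) by blast
  show ?thesis
  proof
    assume "conjugate_by \<mu> f g"
    then have "rf_comp g \<mu> = rf_comp (rf_comp (rf_comp \<mu> f) (mobius_inv \<mu>)) \<mu>"
      by (simp add: conjugate_by_def)
    also have "\<dots> = rf_comp (rf_comp \<mu> f) (rf_comp (mobius_inv \<mu>) \<mu>)"
      by (rule rf_comp_assoc[OF inv(2,1)])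
    finally show "rf_comp g \<mu> = rf_comp \<mu> f"
      by (simp add: inv)
  next
    assume "rf_comp g \<mu> = rf_comp \<mu> f"
    then have "rf_comp (rf_comp \<mu> f) (mobius_inv \<mu>) = rf_comp g (rf_comp \<mu> (mobius_inv \<mu>))"
      by (metis rf_comp_assoc[OF inv(1,2)])
    then show "conjugate_by \<mu> f g"
      by (simp add: conjugate_by_def inv)
  qed
qed

section \<open>Fibre polynomials and ramification indices\<close>

text \<open>
  For \<open>degree p \<le> d\<close> this is the value at \<open>\<gamma>\<close> of the form of degree \<open>d\<close> obtained by homogenizing \<open>p\<close>;
  it lets the point at infinity be treated like any other.
\<close>

fun hom_eval :: "nat \<Rightarrow> 'a::field poly \<Rightarrow> 'a proj_line \<Rightarrow> 'a" where
  "hom_eval d p (Fin x) = poly p x"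
| "hom_eval d p Infty = coeff p d"

text \<open>
  The roots of this polynomial are the finite points with the same image as \<open>\<gamma>\<close>, counted with
  multiplicity; a drop of its degree below \<open>d\<close> is the multiplicity of infinity in this fibre.
\<close>

definition fiber_poly :: "nat \<Rightarrow> 'a::field poly \<Rightarrow> 'a poly \<Rightarrow> 'a proj_line \<Rightarrow> 'a poly" where
  "fiber_poly d p q \<gamma> = smult (hom_eval d q \<gamma>) p - smult (hom_eval d p \<gamma>) q"

fun linear_form :: "'a::field proj_line \<Rightarrow> 'a poly" where
  "linear_form (Fin x) = [:- x, 1:]"
| "linear_form Infty = 1"

definition reverse_poly :: "nat \<Rightarrow> 'a::field poly \<Rightarrow> 'a poly" where
  "reverse_poly d p = (\<Sum>j\<le>d. monom (coeff p (d - j)) j)"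

definition wronskian :: "'a::field poly \<Rightarrow> 'a poly \<Rightarrow> 'a poly" where
  "wronskian p q = pderiv p * q - p * pderiv q"

lemma coeff_reverse_poly: "coeff (reverse_poly d p) k = (if k \<le> d then coeff p (d - k) else 0)"
  by (simp add: reverse_poly_def coeff_sum coeff_monom)

lemma reverse_poly_linear:
  "reverse_poly d (smult a p - smult b q) = smult a (reverse_poly d p) - smult b (reverse_poly d q)"
  by (rule poly_eqI) (simp add: coeff_reverse_poly)

lemma poly_reverse_poly_0: "poly (reverse_poly d p) 0 = coeff p d"
  by (simp add: poly_0_coeff_0 coeff_reverse_poly)

lemma poly_altdef_le:
  fixes p :: "'a::field poly"
  assumes "degree p \<le> n"
  shows "poly p x = (\<Sum>i\<le>n. coeff p i * x ^ i)"
proof -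
  have "poly (\<Sum>i\<le>n. monom (coeff p i) i) x = (\<Sum>i\<le>n. coeff p i * x ^ i)"
    by (simp add: poly_sum poly_monom)
  then show ?thesis
    using poly_as_sum_of_monoms'[OF assms] by simp
qed

lemma poly_reverse_poly:
  assumes "degree p \<le> d" "x \<noteq> 0"
  shows "poly (reverse_poly d p) x = x ^ d * poly p (inverse x)"
proof -
  have "poly (reverse_poly d p) x = (\<Sum>j\<le>d. coeff p (d - j) * x ^ j)"
    by (simp add: reverse_poly_def poly_sum poly_monom)
  also have "\<dots> = (\<Sum>i\<le>d. coeff p i * x ^ (d - i))"
    by (rule sum.reindex_bij_witness[of _ "\<lambda>i. d - i" "\<lambda>i. d - i"]) auto
  also have "\<dots> = (\<Sum>i\<le>d. x ^ d * (coeff p i * inverse x ^ i))"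
    using assms(2) by (intro sum.cong) (simp_all add: power_diff field_simps)
  also have "\<dots> = x ^ d * poly p (inverse x)"
    using assms(1) by (simp add: poly_altdef_le sum_distrib_left)
  finally show ?thesis .
qed

lemma to_fract_reverse_poly:
  assumes "degree p \<le> d"
  shows "to_fract (reverse_poly d p) = rf_z ^ d * rf_ev (1 / rf_z) p"
proof -
  have z: "(rf_z :: 'a ratfun) \<noteq> 0"
    by (simp add: rf_z_def)
  have "to_fract (reverse_poly d p) = (\<Sum>j\<le>d. rf_const (coeff p (d - j)) * rf_z ^ j)"
    by (simp add: reverse_poly_def to_fract_sum to_fract_monom)
  also have "\<dots> = (\<Sum>i\<le>d. rf_const (coeff p i) * rf_z ^ (d - i))"
    by (rule sum.reindex_bij_witness[of _ "\<lambda>i. d - i" "\<lambda>i. d - i"]) auto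
  also have "\<dots> = (\<Sum>i\<le>d. rf_z ^ d * (rf_const (coeff p i) * (1 / rf_z) ^ i))"
    using z by (intro sum.cong) (simp_all add: power_diff field_simps)
  also have "\<dots> = rf_z ^ d * rf_ev (1 / rf_z) p"
    by (simp add: rf_ev_altdef[OF assms] sum_distrib_left)
  finally show ?thesis .
qed

text \<open>
  Reversal is the coordinate change \<open>z \<mapsto> 1 / z\<close>, so a drop in degree becomes a zero at the origin.
\<close>

lemma order_0_reverse_poly:
  assumes "p \<noteq> 0" "degree p \<le> d"
  shows "order 0 (reverse_poly d p) = d - degree p"
proof -
  have "reverse_poly d p = monom 1 (d - degree p) * reflect_poly p"
    using assms(2) by (intro poly_eqI)
      (auto simp: coeff_reverse_poly coeff_monom_mult coeff_reflect_poly coeff_eq_0)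
  then show ?thesis
    using assms by (simp add: order_mult order_0I)
qed

lemma reverse_poly_eq_0_iff: "degree p \<le> d \<Longrightarrow> reverse_poly d p = 0 \<longleftrightarrow> p = 0"
  by (metis coeff_0 coeff_reverse_poly diff_diff_cancel diff_le_self leading_coeff_0_iff poly_eqI)

locale lowest_form =
  fixes p q :: "'a::alg_closed_field poly" and d :: nat
  assumes den_nz: "q \<noteq> 0"
    and coprime: "no_common_root p q"
    and d_eq: "d = max (degree p) (degree q)"
    and d_pos: "d > 0"
begin

abbreviation \<phi> :: "'a ratfun" where
  "\<phi> \<equiv> Fraction_Field.Fract p q"

lemma degree_num_den: "degree p \<le> d" "degree q \<le> d"
  by (simp_all add: d_eq)

text \<open>
  This is where \<open>d > 0\<close> enters: if \<open>p\<close> and \<open>q\<close> were proportional, every root of one would be a common root,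
  so both would be constant.
\<close>

lemma not_proportional:
  assumes "smult t p = smult s q"
  shows "s = 0" "t = 0"
proof -
  have const: "degree r = 0" if "\<And>x. poly r x \<noteq> 0" for r :: "'a poly"
    using that alg_closed_imp_poly_has_root by blast
  have eq: "t * poly p x = s * poly q x" for x
    using assms by (metis poly_smult)
  have deg: "s \<noteq> 0 \<Longrightarrow> t \<noteq> 0 \<Longrightarrow> degree p = degree q"
    using assms by (metis degree_smult_eq)
  have "t = 0"
  proof (rule ccontr)
    assume "t \<noteq> 0"
    have "degree q = 0"
    proof (rule const)
      show "poly q x \<noteq> 0" for x
        using eq[of x] \<open>t \<noteq> 0\<close> coprime by (auto simp: no_common_root_def)
    qed
    moreover have "degree p = 0"
      using assms \<open>t \<noteq> 0\<close> calculation deg by (cases "s = 0") auto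
    ultimately show False
      using d_pos d_eq by simp
  qed
  then show "s = 0" "t = 0"
    using assms den_nz by auto
qed

lemma num_nz: "p \<noteq> 0"
  using not_proportional(2)[of 1 0] by auto

lemma hom_eval_nz: "hom_eval d p \<gamma> \<noteq> 0 \<or> hom_eval d q \<gamma> \<noteq> 0"
proof (cases \<gamma>)
  case (Fin x)
  then show ?thesis
    using coprime by (auto simp: no_common_root_def)
next
  case Infty
  have "d = degree p \<or> d = degree q"
    by (auto simp: d_eq max_def)
  then show ?thesis
    using num_nz den_nz Infty by auto
qed

lemma fiber_poly_nz: "fiber_poly d p q \<gamma> \<noteq> 0"
  using not_proportional hom_eval_nz[of \<gamma>] by (auto simp: fiber_poly_def)

lemma degree_fiber_poly: "degree (fiber_poly d p q \<gamma>) \<le> d"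
  unfolding fiber_poly_def using degree_num_den
  by (intro degree_diff_le) (meson degree_smult_le order_trans)+

lemma degree_fiber_poly_Infty: "degree (fiber_poly d p q Infty) < d"
proof -
  have "coeff (fiber_poly d p q Infty) d = 0"
    by (simp add: fiber_poly_def)
  then show ?thesis
    using degree_fiber_poly[of Infty] fiber_poly_nz[of Infty]
    by (metis le_neq_implies_less leading_coeff_0_iff)
qed

lemma obtain_rf_num_den:
  obtains k where "k \<noteq> 0" "rf_num \<phi> = smult k p" "rf_den \<phi> = smult k q"
  using rf_num_den_Fract[OF den_nz coprime] by blast

lemma rf_degree_eq: "rf_degree \<phi> = d"
  using obtain_rf_num_den by (metis rf_degree_def d_eq degree_smult_eq)

lemma rf_eval_eq:
  "rf_eval \<phi> \<gamma> = (if hom_eval d q \<gamma> = 0 then Infty else Fin (hom_eval d p \<gamma> / hom_eval d q \<gamma>))"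
proof -
  obtain k where "k \<noteq> 0" "rf_num \<phi> = smult k p" "rf_den \<phi> = smult k q"
    by (rule obtain_rf_num_den)
  then show ?thesis
    by (cases \<gamma>) (simp_all add: rf_degree_eq)
qed

lemma ram_fin_eq: "ram_fin \<phi> x = order x (fiber_poly d p q (Fin x))"
proof -
  obtain k where k: "k \<noteq> 0" "rf_num \<phi> = smult k p" "rf_den \<phi> = smult k q"
    by (rule obtain_rf_num_den)
  have "smult (poly (rf_den \<phi>) x) (rf_num \<phi>) - smult (poly (rf_num \<phi>) x) (rf_den \<phi>)
      = smult (k * k) (fiber_poly d p q (Fin x))"
    by (simp add: k fiber_poly_def smult_diff_right mult_ac)
  then show ?thesis
    using k(1) by (simp add: ram_fin_def order_smult)
qed

lemma reverse_lowest_form: "lowest_form (reverse_poly d q) (reverse_poly d p) d"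
proof
  show "reverse_poly d p \<noteq> 0"
    using reverse_poly_eq_0_iff[OF degree_num_den(1)] num_nz by simp
  show "no_common_root (reverse_poly d q) (reverse_poly d p)"
    unfolding no_common_root_def
  proof
    fix x show "\<not> (poly (reverse_poly d q) x = 0 \<and> poly (reverse_poly d p) x = 0)"
    proof (cases "x = 0")
      case True
      then show ?thesis
        using hom_eval_nz[of Infty] by (auto simp: poly_reverse_poly_0)
    next
      case False
      then show ?thesis
        using coprime by (auto simp: poly_reverse_poly degree_num_den no_common_root_def)
    qed
  qed
  have "degree (reverse_poly d r) \<le> d" for r :: "'a poly"
    by (rule degree_le) (simp add: coeff_reverse_poly)
  moreover have "coeff (reverse_poly d q) d \<noteq> 0 \<or> coeff (reverse_poly d p) d \<noteq> 0"
    using coprime by (auto simp: coeff_reverse_poly no_common_root_def poly_0_coeff_0[symmetric])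
  then have "d \<le> degree (reverse_poly d q) \<or> d \<le> degree (reverse_poly d p)"
    using le_degree by blast
  ultimately show "d = max (degree (reverse_poly d q)) (degree (reverse_poly d p))"
    by (metis max.commute max_absorb1 order_antisym)
  show "d > 0"
    by (rule d_pos)
qed

text \<open>
  In the coordinate \<open>1 / z\<close> the map \<open>1 / \<phi>(1 / z)\<close> is represented by the reversed polynomials, with
  numerator and denominator exchanged.
\<close>

lemma ram_index_Infty_eq: "ram_index \<phi> Infty = d - degree (fiber_poly d p q Infty)"
proof -
  interpret rev: lowest_form "reverse_poly d q" "reverse_poly d p" d
    by (rule reverse_lowest_form)
  have "nonconst (1 / rf_z :: 'a ratfun)"
    using nonconst_mobius[OF nonconst_z, of 0 0 1 1] by (simp add: mobius_def)
  then have "rf_comp \<phi> (1 / rf_z) = rf_ev (1 / rf_z) p / rf_ev (1 / rf_z) q"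
    by (rule rf_comp_Fract[OF _ den_nz])
  also have "\<dots> = to_fract (reverse_poly d p) / to_fract (reverse_poly d q)"
    by (simp add: to_fract_reverse_poly degree_num_den) (simp add: rf_z_def)
  finally have "1 / rf_comp \<phi> (1 / rf_z) = rev.\<phi>"
    by (simp add: Fract_conv_to_fract)
  then have "ram_index \<phi> Infty = order 0 (fiber_poly d (reverse_poly d q) (reverse_poly d p) (Fin 0))"
    by (simp add: rev.ram_fin_eq)
  also have "fiber_poly d (reverse_poly d q) (reverse_poly d p) (Fin 0)
      = - reverse_poly d (fiber_poly d p q Infty)"
    by (simp add: fiber_poly_def poly_reverse_poly_0 reverse_poly_linear)
  finally show ?thesis
    by (simp add: order_0_reverse_poly fiber_poly_nz degree_fiber_poly)
qed

end

section \<open>Total ramification at both critical points\<close>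

lemma coeff_mult_degree_bound:
  fixes p q :: "'a::comm_ring_1 poly"
  assumes "degree p \<le> m" "degree q \<le> n"
  shows "coeff (p * q) (m + n) = coeff p m * coeff q n"
proof -
  have "coeff (p * q) (m + n) = (\<Sum>i\<le>m+n. coeff p i * coeff q (m + n - i))"
    by (rule coeff_mult)
  also have "\<dots> = (\<Sum>i\<le>m+n. if i = m then coeff p m * coeff q n else 0)"
  proof (rule sum.cong)
    fix i
    have "i < m \<Longrightarrow> n < m + n - i" by simp
    then show "coeff p i * coeff q (m + n - i) = (if i = m then coeff p m * coeff q n else 0)"
      using assms by (cases i m rule: linorder_cases) (simp_all add: coeff_eq_0)
  qed simp
  finally show ?thesis
    by simp
qed

lemma size_proots_alg_closed:
  fixes p :: "'a::alg_closed_field poly"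
  shows "size (proots p) = degree p"
proof (induction "degree p" arbitrary: p)
  case 0
  then obtain c where "p = [:c:]"
    by (metis degree_eq_zeroE)
  then show ?case
    by simp
next
  case (Suc n)
  then obtain r where "poly p r = 0"
    using alg_closed_imp_poly_has_root[of p] by auto
  then obtain s where p: "p = [:-r, 1:] * s"
    using poly_eq_0_iff_dvd by (metis dvdE)
  then have "s \<noteq> 0"
    using Suc.hyps(2) by auto
  then have "degree p = Suc (degree s)"
    unfolding p by (subst degree_mult_eq) auto
  moreover have "proots p = {#r#} + proots s"
    using \<open>s \<noteq> 0\<close> unfolding p by (subst proots_mult) auto
  ultimately show ?case
    using Suc.hyps by simp
qed

lemma of_nat_neq_0:
  assumes "CHAR('a::semiring_1) = 0 \<or> CHAR('a) > d" "0 < n" "n \<le> d"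
  shows "of_nat n \<noteq> (0 :: 'a)"
  using assms by (auto simp: of_nat_eq_0_iff_char_dvd dvd_imp_le dest: dvd_imp_le)

context lowest_form
begin

text \<open>
  Up to a constant, the Wronskian does not change if one of the two polynomials is replaced by
  the fibre polynomial at \<open>\<gamma>\<close>.  Whichever of \<open>p\<close> and \<open>q\<close> is nonzero at \<open>\<gamma>\<close> can be kept as the other.
\<close>

lemma wronskian_fiber_poly:
  obtains r where "r \<in> {p, q}" "hom_eval d r \<gamma> \<noteq> 0"
    "smult (hom_eval d r \<gamma>) (wronskian p q)
       = pderiv (fiber_poly d p q \<gamma>) * r - fiber_poly d p q \<gamma> * pderiv r"
proof (cases "hom_eval d q \<gamma> = 0")
  case False
  have "smult (hom_eval d q \<gamma>) (wronskian p q)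
       = pderiv (fiber_poly d p q \<gamma>) * q - fiber_poly d p q \<gamma> * pderiv q"
    by (simp add: wronskian_def fiber_poly_def pderiv_diff pderiv_smult algebra_simps smult_diff_right)
  with False show ?thesis
    using that[of q] by blast
next
  case True
  then have "hom_eval d p \<gamma> \<noteq> 0"
    using hom_eval_nz by blast
  moreover have "smult (hom_eval d p \<gamma>) (wronskian p q)
       = pderiv (fiber_poly d p q \<gamma>) * p - fiber_poly d p q \<gamma> * pderiv p"
    by (simp add: wronskian_def fiber_poly_def pderiv_diff pderiv_smult algebra_simps smult_diff_right)
  ultimately show ?thesis
    using that[of p] by blast
qed

lemma ram_fin_bounds: "0 < ram_index \<phi> (Fin x)" "ram_index \<phi> (Fin x) \<le> d"
proof -
  have "poly (fiber_poly d p q (Fin x)) x = 0"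
    by (simp add: fiber_poly_def)
  then show "0 < ram_index \<phi> (Fin x)"
    using fiber_poly_nz by (simp add: ram_fin_eq order_gt_0_iff)
  show "ram_index \<phi> (Fin x) \<le> d"
    using order_degree[OF fiber_poly_nz, of x "Fin x"] degree_fiber_poly[of "Fin x"]
    by (simp add: ram_fin_eq)
qed

lemma ram_Infty_bounds: "0 < ram_index \<phi> Infty" "ram_index \<phi> Infty \<le> d"
  using degree_fiber_poly_Infty by (simp_all add: ram_index_Infty_eq del: ram_index.simps)

lemma ram_index_le: "ram_index \<phi> \<gamma> \<le> d"
  using ram_fin_bounds ram_Infty_bounds by (cases \<gamma>) blast+

text \<open>
  Let \<open>F\<close> be the fibre polynomial at \<open>x\<close>, with a zero of order \<open>e\<close> there.  Since \<open>e \<le> d\<close> is not zero in the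
  field, \<open>F'\<close> vanishes to order exactly \<open>e - 1\<close>, and so does \<open>F' r - F r'\<close> when \<open>r(x) \<noteq> 0\<close>.
\<close>

lemma wronskian_order:
  assumes "CHAR('a) = 0 \<or> CHAR('a) > d"
  shows "wronskian p q \<noteq> 0 \<and> order x (wronskian p q) < ram_index \<phi> (Fin x)"
proof -
  define F where "F = fiber_poly d p q (Fin x)"
  define e where "e = order x F"
  let ?l = "[:- x, 1:]"
  have e: "ram_index \<phi> (Fin x) = e" "0 < e" "e \<le> d"
    using ram_fin_bounds[of x] by (simp_all add: e_def F_def ram_fin_eq)
  have "F \<noteq> 0"
    by (simp add: F_def fiber_poly_nz)
  obtain r where r: "hom_eval d r (Fin x) \<noteq> 0"
    "smult (hom_eval d r (Fin x)) (wronskian p q) = pderiv F * r - F * pderiv r"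
    using wronskian_fiber_poly unfolding F_def by metis
  obtain G where G: "F = ?l ^ e * G" "\<not> ?l dvd G"
    using order_decomp[OF \<open>F \<noteq> 0\<close>] unfolding e_def by blast
  have "\<not> ?l ^ e dvd wronskian p q"
  proof
    assume "?l ^ e dvd wronskian p q"
    then have "?l ^ e dvd smult (hom_eval d r (Fin x)) (wronskian p q) + F * pderiv r"
      using G(1) by (intro dvd_add dvd_smult) auto
    then have "?l ^ e dvd pderiv F * r"
      unfolding r(2) by simp
    moreover obtain k where k: "e = Suc k"
      using e(2) gr0_implies_Suc by blast
    have "pderiv F * r = ?l ^ k * ((smult (of_nat e) G + ?l * pderiv G) * r)"
      unfolding G(1) k lemma_order_pderiv1 by (simp add: algebra_simps)
    ultimately have "?l ^ k * ?l dvd ?l ^ k * ((smult (of_nat e) G + ?l * pderiv G) * r)"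
      unfolding k by (metis power_Suc2)
    then have "?l dvd (smult (of_nat e) G + ?l * pderiv G) * r"
      by (subst (asm) dvd_mult_cancel_left) auto
    then have "of_nat e * poly G x * poly r x = 0"
      by (simp flip: poly_eq_0_iff_dvd)
    moreover have "of_nat e \<noteq> (0 :: 'a)"
      using assms e(2,3) by (rule of_nat_neq_0)
    ultimately show False
      using r(1) G(2) by (simp add: poly_eq_0_iff_dvd)
  qed
  then show ?thesis
    using e(1) by (auto simp: order_divides)
qed

text \<open>
  The counterpart at infinity.  Here the fibre polynomial \<open>F\<close> has degree \<open>f < d\<close>, and the coefficient of
  \<open>F' r - F r'\<close> at exponent \<open>f + d - 1\<close> is a nonzero multiple of \<open>f - d\<close>, which does not vanish in
  the field because \<open>0 < d - f \<le> d\<close>.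
\<close>

lemma wronskian_degree:
  assumes "CHAR('a) = 0 \<or> CHAR('a) > d"
  shows "2 * d \<le> Suc (degree (wronskian p q) + ram_index \<phi> Infty)"
proof -
  define F where "F = fiber_poly d p q Infty"
  define f where "f = degree F"
  have f: "f < d" "ram_index \<phi> Infty = d - f"
    using degree_fiber_poly_Infty unfolding f_def F_def by (simp_all add: ram_index_Infty_eq del: ram_index.simps)
  have "F \<noteq> 0"
    by (simp add: F_def fiber_poly_nz)
  obtain r where r: "r \<in> {p, q}" "coeff r d \<noteq> 0"
    "smult (coeff r d) (wronskian p q) = pderiv F * r - F * pderiv r"
    using wronskian_fiber_poly[of Infty] unfolding F_def by (metis hom_eval.simps(2))
  \<comment> \<open>Multiplying derivatives by the variable avoids the truncated exponents \<open>f - 1\<close> and \<open>d - 1\<close>: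
    the coefficients of \<open>z g'\<close> are \<open>i g\<^sub>i\<close>, also for \<open>i = 0\<close>.\<close>
  have x_pderiv: "coeff (pCons 0 (pderiv g)) i = of_nat i * coeff g i" for g :: "'a poly" and i
    by (cases i) (simp_all add: coeff_pderiv)
  have x_pderiv_deg: "degree (pCons 0 (pderiv g)) \<le> degree g" for g :: "'a poly"
    by (rule degree_le) (simp only: x_pderiv, simp add: coeff_eq_0)
  have deg_r: "degree r = d"
    using r(1,2) degree_num_den le_degree[of r d] by (auto intro: antisym)
  have "smult (coeff r d) (pCons 0 (wronskian p q))
      = pCons 0 (pderiv F) * r - F * pCons 0 (pderiv r)"
    using r(3) by simp
  then have "coeff r d * coeff (pCons 0 (wronskian p q)) (f + d)
      = coeff (pCons 0 (pderiv F) * r) (f + d) - coeff (F * pCons 0 (pderiv r)) (f + d)"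
    by (metis coeff_diff coeff_smult)
  also have "\<dots> = of_nat f * coeff F f * coeff r d - coeff F f * (of_nat d * coeff r d)"
    using x_pderiv_deg[of F] x_pderiv_deg[of r] deg_r
    by (simp only: coeff_mult_degree_bound[of _ f _ d] f_def[symmetric] x_pderiv)
  also have "\<dots> = - (of_nat (d - f) * coeff F f * coeff r d)"
    using f(1) by (simp add: of_nat_diff algebra_simps)
  also have "\<dots> \<noteq> 0"
    using r(2) \<open>F \<noteq> 0\<close> of_nat_neq_0[OF assms, of "d - f"] f(1) by (simp add: f_def)
  finally have "coeff (pCons 0 (wronskian p q)) (f + d) \<noteq> 0"
    by auto
  then have "coeff (wronskian p q) (f + d - 1) \<noteq> 0"
    using d_pos by (cases "f + d") auto
  then have "f + d - 1 \<le> degree (wronskian p q)"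
    by (rule le_degree)
  then show ?thesis
    using f by simp
qed

text \<open>
  Roots of the Wronskian are critical points, so its degree is at most the sum of the \<open>e - 1\<close> over the
  finite critical points; by \<open>wronskian_degree\<close> it is at least \<open>2 d - 1\<close> minus the index at infinity.
  With only two critical points, each of index at most \<open>d\<close>, both bounds are attained.
\<close>

lemma bicritical_totally_ramified:
  assumes char: "CHAR('a) = 0 \<or> CHAR('a) > d"
    and crit: "critical_points \<phi> = {\<gamma>\<^sub>1, \<gamma>\<^sub>2}" "\<gamma>\<^sub>1 \<noteq> \<gamma>\<^sub>2"
  shows "ram_index \<phi> \<gamma>\<^sub>1 = d" "ram_index \<phi> \<gamma>\<^sub>2 = d"
proof -
  let ?W = "wronskian p q"
  define S where "S = {x. Fin x \<in> {\<gamma>\<^sub>1, \<gamma>\<^sub>2}}"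
  have finS: "finite S"
    by (rule finite_subset[of _ "(\<lambda>\<gamma>. case \<gamma> of Fin x \<Rightarrow> x | Infty \<Rightarrow> 0) ` {\<gamma>\<^sub>1, \<gamma>\<^sub>2}"])
       (force simp: S_def image_iff)+
  have W: "?W \<noteq> 0" and ord: "order x ?W < ram_index \<phi> (Fin x)" for x
    using wronskian_order[OF char] by blast+
  have "x \<in> S" if "order x ?W \<noteq> 0" for x
  proof -
    have "1 < ram_index \<phi> (Fin x)"
      using ord[of x] that by linarith
    then have "Fin x \<in> critical_points \<phi>"
      unfolding critical_points_def by blast
    then show ?thesis
      unfolding crit S_def by blast
  qed
  then have sub: "set_mset (proots ?W) \<subseteq> S"
    using W by (auto simp: order_root)
  have "degree ?W = (\<Sum>x\<in>set_mset (proots ?W). order x ?W)"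
    using W by (simp add: size_multiset_overloaded_eq flip: size_proots_alg_closed)
  also have "\<dots> = (\<Sum>x\<in>S. order x ?W)"
    using finS sub W by (intro sum.mono_neutral_left) (auto simp: order_root)
  also have "\<dots> \<le> (\<Sum>x\<in>S. ram_index \<phi> (Fin x) - 1)"
  proof (rule sum_mono)
    show "order x ?W \<le> ram_index \<phi> (Fin x) - 1" for x
      using ord[of x] by linarith
  qed
  finally have deg: "degree ?W \<le> (\<Sum>x\<in>S. ram_index \<phi> (Fin x) - 1)" .
  have "2 * d \<le> Suc (degree ?W + ram_index \<phi> Infty)"
    by (rule wronskian_degree[OF char])
  with deg have ge: "2 * d \<le> Suc ((\<Sum>x\<in>S. ram_index \<phi> (Fin x) - 1) + ram_index \<phi> Infty)"
    by simp
  note le = ram_index_le[of \<gamma>\<^sub>1] ram_index_le[of \<gamma>\<^sub>2]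
  note pos = ram_fin_bounds(1) ram_Infty_bounds(1)
  have "ram_index \<phi> \<gamma>\<^sub>1 = d \<and> ram_index \<phi> \<gamma>\<^sub>2 = d"
  proof (cases \<gamma>\<^sub>1; cases \<gamma>\<^sub>2)
    fix x y assume xy: "\<gamma>\<^sub>1 = Fin x" "\<gamma>\<^sub>2 = Fin y"
    then have "Infty \<notin> critical_points \<phi>"
      using crit(1) by auto
    then have "ram_index \<phi> Infty \<le> 1"
      by (simp add: critical_points_def)
    moreover have "S = {x, y}" "x \<noteq> y"
      using xy crit(2) by (auto simp: S_def)
    then have "(\<Sum>x\<in>S. ram_index \<phi> (Fin x) - 1)
        = (ram_index \<phi> (Fin x) - 1) + (ram_index \<phi> (Fin y) - 1)"
      by (simp del: ram_index.simps)
    ultimately show ?thesis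
      using ge le pos(1)[of x] pos(1)[of y] unfolding xy by linarith
  next
    fix x assume xy: "\<gamma>\<^sub>1 = Fin x" "\<gamma>\<^sub>2 = Infty"
    then have "S = {x}"
      by (auto simp: S_def)
    then have "(\<Sum>x\<in>S. ram_index \<phi> (Fin x) - 1) = ram_index \<phi> (Fin x) - 1"
      by (simp del: ram_index.simps)
    then show ?thesis
      using ge le pos(1)[of x] unfolding xy by linarith
  next
    fix y assume xy: "\<gamma>\<^sub>1 = Infty" "\<gamma>\<^sub>2 = Fin y"
    then have "S = {y}"
      by (auto simp: S_def)
    then have "(\<Sum>x\<in>S. ram_index \<phi> (Fin x) - 1) = ram_index \<phi> (Fin y) - 1"
      by (simp del: ram_index.simps)
    then show ?thesis
      using ge le pos(1)[of y] unfolding xy by linarith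
  next
    assume "\<gamma>\<^sub>1 = Infty" "\<gamma>\<^sub>2 = Infty"
    then show ?thesis
      using crit(2) by simp
  qed
  then show "ram_index \<phi> \<gamma>\<^sub>1 = d" "ram_index \<phi> \<gamma>\<^sub>2 = d"
    by simp_all
qed

lemma fiber_poly_eq_power:
  assumes "ram_index \<phi> \<gamma> = d"
  shows "fiber_poly d p q \<gamma>
    = smult (lead_coeff (fiber_poly d p q \<gamma>)) (linear_form \<gamma> ^ d)"
proof (cases \<gamma>)
  case (Fin x)
  let ?F = "fiber_poly d p q (Fin x)"
  have "[:- x, 1:] ^ d dvd ?F"
    using assms Fin order_1[of x ?F] by (simp add: ram_fin_eq)
  then obtain k where k: "?F = [:- x, 1:] ^ d * k"
    by (elim dvdE)
  then have "k \<noteq> 0"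
    using fiber_poly_nz[of "Fin x"] by auto
  then have "d + degree k = degree ?F"
    unfolding k by (subst degree_mult_eq) (auto simp: degree_power_eq)
  then have "degree k = 0"
    using degree_fiber_poly[of "Fin x"] by simp
  then obtain c where "k = [:c:]"
    by (metis degree_eq_zeroE)
  then have c: "?F = smult c ([:- x, 1:] ^ d)"
    using k by simp
  have "lead_coeff ([:- x, 1:] ^ d) = 1"
    by (simp add: lead_coeff_power)
  then have "lead_coeff ?F = c"
    unfolding c lead_coeff_smult by simp
  then show ?thesis
    unfolding Fin linear_form.simps using c by metis
next
  case Infty
  then have "degree (fiber_poly d p q Infty) = 0"
    using assms degree_fiber_poly_Infty by (simp add: ram_index_Infty_eq del: ram_index.simps)
  then obtain c where "fiber_poly d p q Infty = [:c:]"
    by (metis degree_eq_zeroE)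
  then show ?thesis
    using Infty by simp
qed

end

section \<open>Normal forms\<close>

text \<open>
  Infinity has the coordinates \<open>(-1 : 0)\<close>, with this sign so that the form \<open>y z - x\<close> that vanishes
  there is \<open>1\<close>, and all linear forms are monic.
\<close>

fun proj_x :: "'a::field proj_line \<Rightarrow> 'a" where
  "proj_x (Fin x) = x"
| "proj_x Infty = - 1"

fun proj_y :: "'a::field proj_line \<Rightarrow> 'a" where
  "proj_y (Fin x) = 1"
| "proj_y Infty = 0"

lemma linear_form_eq: "linear_form \<gamma> = [:- proj_x \<gamma>, proj_y \<gamma>:]"
  by (cases \<gamma>) (simp_all add: one_pCons)

lemma linear_form_nz: "linear_form \<gamma> \<noteq> 0"
  by (cases \<gamma>) simp_all

lemma proj_coords_det: "\<gamma> \<noteq> \<delta> \<Longrightarrow> proj_x \<gamma> * proj_y \<delta> - proj_y \<gamma> * proj_x \<delta> \<noteq> 0"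
  by (cases \<gamma>; cases \<delta>) auto

locale totally_ramified_pair = lowest_form p q d
  for p q :: "'a::alg_closed_field poly" and d +
  fixes \<gamma>\<^sub>1 \<gamma>\<^sub>2 :: "'a proj_line" and L :: "'a set"
  assumes subfield: "is_subfield L"
    and over: "p \<in> polys_over L" "q \<in> polys_over L"
    and coords: "proj_x \<gamma>\<^sub>1 \<in> L" "proj_x \<gamma>\<^sub>2 \<in> L" "proj_y \<gamma>\<^sub>1 \<in> L" "proj_y \<gamma>\<^sub>2 \<in> L"
    and distinct: "\<gamma>\<^sub>1 \<noteq> \<gamma>\<^sub>2"
    and total: "ram_index \<phi> \<gamma>\<^sub>1 = d" "ram_index \<phi> \<gamma>\<^sub>2 = d"
begin

lemma swapped: "totally_ramified_pair p q d \<gamma>\<^sub>2 \<gamma>\<^sub>1 L"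
  using subfield over coords distinct total by unfold_locales auto

text \<open>
  The linear form of \<open>\<delta>\<close> evaluated at the homogeneous coordinates of the image of \<open>\<gamma>\<close>.
\<close>

definition incidence :: "'a proj_line \<Rightarrow> 'a proj_line \<Rightarrow> 'a" where
  "incidence \<delta> \<gamma> = proj_y \<delta> * hom_eval d p \<gamma> - proj_x \<delta> * hom_eval d q \<gamma>"

lemma incidence_eq_0_iff: "incidence \<delta> \<gamma> = 0 \<longleftrightarrow> rf_eval \<phi> \<gamma> = \<delta>"
proof (cases \<delta>)
  case (Fin x)
  then show ?thesis
    using hom_eval_nz[of \<gamma>] by (auto simp: incidence_def rf_eval_eq field_simps)
next
  case Infty
  then show ?thesis
    by (auto simp: incidence_def rf_eval_eq)
qed

lemma nonconst_\<phi>: "nonconst \<phi>"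
  unfolding nonconst_def
proof (intro allI notI)
  fix c assume "\<phi> = rf_const c"
  then have "to_fract p = to_fract (smult c q)"
    using den_nz by (simp add: Fract_conv_to_fract field_simps to_fract_smult)
  then have "smult 1 p = smult c q"
    by simp
  then show False
    using not_proportional(2) by (metis one_neq_zero)
qed

text \<open>
  The two critical values are distinct.  Otherwise the two fibre polynomials would be proportional,
  whereas one vanishes only at \<open>\<gamma>\<^sub>1\<close> and the other only at \<open>\<gamma>\<^sub>2\<close>.
\<close>

lemma values_det:
  "hom_eval d p \<gamma>\<^sub>1 * hom_eval d q \<gamma>\<^sub>2 - hom_eval d p \<gamma>\<^sub>2 * hom_eval d q \<gamma>\<^sub>1 \<noteq> 0"
proof
  let ?F = "fiber_poly d p q"
  assume "hom_eval d p \<gamma>\<^sub>1 * hom_eval d q \<gamma>\<^sub>2 - hom_eval d p \<gamma>\<^sub>2 * hom_eval d q \<gamma>\<^sub>1 = 0"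
  then have eq: "smult (hom_eval d q \<gamma>\<^sub>2) (?F \<gamma>\<^sub>1) = smult (hom_eval d q \<gamma>\<^sub>1) (?F \<gamma>\<^sub>2)"
      "smult (hom_eval d p \<gamma>\<^sub>2) (?F \<gamma>\<^sub>1) = smult (hom_eval d p \<gamma>\<^sub>1) (?F \<gamma>\<^sub>2)"
    by (simp_all add: fiber_poly_def smult_diff_right mult_ac)
  have same: "poly (?F \<gamma>\<^sub>1) x = 0 \<longleftrightarrow> poly (?F \<gamma>\<^sub>2) x = 0" for x
  proof -
    have "hom_eval d q \<gamma>\<^sub>2 * poly (?F \<gamma>\<^sub>1) x = hom_eval d q \<gamma>\<^sub>1 * poly (?F \<gamma>\<^sub>2) x"
        "hom_eval d p \<gamma>\<^sub>2 * poly (?F \<gamma>\<^sub>1) x = hom_eval d p \<gamma>\<^sub>1 * poly (?F \<gamma>\<^sub>2) x"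
      using eq by (metis poly_smult)+
    then show ?thesis
      using hom_eval_nz[of \<gamma>\<^sub>1] hom_eval_nz[of \<gamma>\<^sub>2] by (metis mult_eq_0_iff)
  qed
  have root: "poly (?F \<gamma>) x = 0 \<longleftrightarrow> \<gamma> = Fin x" if "ram_index \<phi> \<gamma> = d" for \<gamma> x
  proof -
    have "poly (?F \<gamma>) x = lead_coeff (?F \<gamma>) * poly (linear_form \<gamma>) x ^ d"
      using fiber_poly_eq_power[OF that] by (metis poly_power poly_smult)
    then show ?thesis
      using fiber_poly_nz[of \<gamma>] d_pos by (cases \<gamma>) auto
  qed
  show False
    using same distinct root[OF total(1)] root[OF total(2)] by (cases \<gamma>\<^sub>1; cases \<gamma>\<^sub>2) auto
qed

lemma values_distinct: "rf_eval \<phi> \<gamma>\<^sub>1 \<noteq> rf_eval \<phi> \<gamma>\<^sub>2"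
  using values_det hom_eval_nz[of \<gamma>\<^sub>1] hom_eval_nz[of \<gamma>\<^sub>2]
  by (auto simp: rf_eval_eq frac_eq_eq split: if_splits)

lemma incidence_det:
  "incidence \<gamma>\<^sub>1 \<gamma>\<^sub>1 * incidence \<gamma>\<^sub>2 \<gamma>\<^sub>2 - incidence \<gamma>\<^sub>1 \<gamma>\<^sub>2 * incidence \<gamma>\<^sub>2 \<gamma>\<^sub>1 \<noteq> 0"
proof -
  have "incidence \<gamma>\<^sub>1 \<gamma>\<^sub>1 * incidence \<gamma>\<^sub>2 \<gamma>\<^sub>2 - incidence \<gamma>\<^sub>1 \<gamma>\<^sub>2 * incidence \<gamma>\<^sub>2 \<gamma>\<^sub>1
    = (proj_x \<gamma>\<^sub>1 * proj_y \<gamma>\<^sub>2 - proj_y \<gamma>\<^sub>1 * proj_x \<gamma>\<^sub>2) *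
      (hom_eval d p \<gamma>\<^sub>1 * hom_eval d q \<gamma>\<^sub>2 - hom_eval d p \<gamma>\<^sub>2 * hom_eval d q \<gamma>\<^sub>1)"
    unfolding incidence_def by algebra
  then show ?thesis
    using values_det proj_coords_det[OF distinct] by simp
qed

lemma incidence_in_L:
  "incidence \<gamma>\<^sub>1 \<gamma>\<^sub>1 \<in> L" "incidence \<gamma>\<^sub>1 \<gamma>\<^sub>2 \<in> L" "incidence \<gamma>\<^sub>2 \<gamma>\<^sub>1 \<in> L" "incidence \<gamma>\<^sub>2 \<gamma>\<^sub>2 \<in> L"
  and hom_eval_in_L: "hom_eval d p \<gamma>\<^sub>1 \<in> L" "hom_eval d p \<gamma>\<^sub>2 \<in> L" "hom_eval d q \<gamma>\<^sub>1 \<in> L" "hom_eval d q \<gamma>\<^sub>2 \<in> L"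
proof -
  have val: "hom_eval d r \<gamma> \<in> L" if "r \<in> polys_over L" "proj_x \<gamma> \<in> L" for r \<gamma>
    using that subfield by (cases \<gamma>) (auto simp: poly_in_subfield polys_over_def)
  show "hom_eval d p \<gamma>\<^sub>1 \<in> L" "hom_eval d p \<gamma>\<^sub>2 \<in> L" "hom_eval d q \<gamma>\<^sub>1 \<in> L" "hom_eval d q \<gamma>\<^sub>2 \<in> L"
    by (intro val over coords)+
  then show "incidence \<gamma>\<^sub>1 \<gamma>\<^sub>1 \<in> L" "incidence \<gamma>\<^sub>1 \<gamma>\<^sub>2 \<in> L" "incidence \<gamma>\<^sub>2 \<gamma>\<^sub>1 \<in> L" "incidence \<gamma>\<^sub>2 \<gamma>\<^sub>2 \<in> L"
    unfolding incidence_def using subfield coords by simp_all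
qed

text \<open>
  The coordinate \<open>\<kappa> l\<^sub>1 / l\<^sub>2\<close>, which takes \<open>\<gamma>\<^sub>1\<close> to \<open>0\<close> and \<open>\<gamma>\<^sub>2\<close> to infinity.  The scale \<open>\<kappa>\<close> is
  kept free for the third normal form.
\<close>

definition coord_mobius :: "'a \<Rightarrow> 'a ratfun" where
  "coord_mobius \<kappa> = mobius (\<kappa> * proj_y \<gamma>\<^sub>1) (- \<kappa> * proj_x \<gamma>\<^sub>1) (proj_y \<gamma>\<^sub>2) (- proj_x \<gamma>\<^sub>2) rf_z"

lemma coord_mobius_PGL2:
  assumes "\<kappa> \<in> L" "\<kappa> \<noteq> 0"
  shows "coord_mobius \<kappa> \<in> PGL2 L" "coord_mobius \<kappa> \<in> PGL2 UNIV" "nonconst (coord_mobius \<kappa>)"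
proof -
  have "\<kappa> * proj_y \<gamma>\<^sub>1 * - proj_x \<gamma>\<^sub>2 - - \<kappa> * proj_x \<gamma>\<^sub>1 * proj_y \<gamma>\<^sub>2
      = \<kappa> * (proj_x \<gamma>\<^sub>1 * proj_y \<gamma>\<^sub>2 - proj_y \<gamma>\<^sub>1 * proj_x \<gamma>\<^sub>2)"
    by (simp add: algebra_simps)
  then have det: "\<kappa> * proj_y \<gamma>\<^sub>1 * - proj_x \<gamma>\<^sub>2 - - \<kappa> * proj_x \<gamma>\<^sub>1 * proj_y \<gamma>\<^sub>2 \<noteq> 0"
    using assms(2) proj_coords_det[OF distinct] by simp
  moreover have "\<kappa> * proj_y \<gamma>\<^sub>1 \<in> L" "- \<kappa> * proj_x \<gamma>\<^sub>1 \<in> L" "proj_y \<gamma>\<^sub>2 \<in> L" "- proj_x \<gamma>\<^sub>2 \<in> L"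
    using subfield coords assms(1) by simp_all
  ultimately show "coord_mobius \<kappa> \<in> PGL2 L"
    unfolding PGL2_iff coord_mobius_def by blast
  show "coord_mobius \<kappa> \<in> PGL2 UNIV"
    unfolding PGL2_iff coord_mobius_def using det by blast
  show "nonconst (coord_mobius \<kappa>)"
    unfolding coord_mobius_def using nonconst_z det by (rule nonconst_mobius)
qed

definition "fiber_lc\<^sub>1 = lead_coeff (fiber_poly d p q \<gamma>\<^sub>1)"
definition "fiber_lc\<^sub>2 = lead_coeff (fiber_poly d p q \<gamma>\<^sub>2)"

lemma fiber_lc_props: "fiber_lc\<^sub>1 \<in> L" "fiber_lc\<^sub>2 \<in> L" "fiber_lc\<^sub>1 \<noteq> 0" "fiber_lc\<^sub>2 \<noteq> 0"
proof -
  have coeff: "coeff (smult a p - smult b q) n \<in> L" if "a \<in> L" "b \<in> L" for a b n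
    using that over subfield by (simp add: polys_over_def)
  show "fiber_lc\<^sub>1 \<in> L" "fiber_lc\<^sub>2 \<in> L"
    unfolding fiber_lc\<^sub>1_def fiber_lc\<^sub>2_def fiber_poly_def by (intro coeff hom_eval_in_L)+
  show "fiber_lc\<^sub>1 \<noteq> 0" "fiber_lc\<^sub>2 \<noteq> 0"
    by (simp_all add: fiber_lc\<^sub>1_def fiber_lc\<^sub>2_def fiber_poly_nz)
qed

text \<open>
  Total ramification gives \<open>t\<^sub>i p - s\<^sub>i q = a\<^sub>i l\<^sub>i\<^sup>d\<close>, where \<open>(s\<^sub>i : t\<^sub>i)\<close> is the image of \<open>\<gamma>\<^sub>i\<close>.  Solving
  this linear system for \<open>p\<close> and \<open>q\<close>, its determinant \<open>\<Delta>\<close> being nonzero, and substituting into \<open>\<mu> \<circ> \<phi>\<close>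
  leaves a quotient of two combinations of \<open>l\<^sub>1\<^sup>d\<close> and \<open>l\<^sub>2\<^sup>d\<close>, that is, a fractional linear
  function of \<open>\<mu>\<^sup>d\<close>.
\<close>

lemma conjugate_coord_mobius_iff:
  assumes "\<kappa> \<in> L" "\<kappa> \<noteq> 0"
  shows "conjugate_by (coord_mobius \<kappa>) \<phi> g \<longleftrightarrow> rf_comp g (coord_mobius \<kappa>) =
    mobius (\<kappa> * fiber_lc\<^sub>1 * incidence \<gamma>\<^sub>1 \<gamma>\<^sub>2) (- \<kappa> * \<kappa> ^ d * fiber_lc\<^sub>2 * incidence \<gamma>\<^sub>1 \<gamma>\<^sub>1)
           (fiber_lc\<^sub>1 * incidence \<gamma>\<^sub>2 \<gamma>\<^sub>2) (- (\<kappa> ^ d) * fiber_lc\<^sub>2 * incidence \<gamma>\<^sub>2 \<gamma>\<^sub>1) (coord_mobius \<kappa> ^ d)"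
proof -
  let ?\<mu> = "coord_mobius \<kappa>"
  define P Q where "P = to_fract p" and "Q = to_fract q"
  define l\<^sub>1 l\<^sub>2 where "l\<^sub>1 = to_fract (linear_form \<gamma>\<^sub>1)" and "l\<^sub>2 = to_fract (linear_form \<gamma>\<^sub>2)"
  define s\<^sub>1 s\<^sub>2 t\<^sub>1 t\<^sub>2 where st: "s\<^sub>1 = rf_const (hom_eval d p \<gamma>\<^sub>1)" "s\<^sub>2 = rf_const (hom_eval d p \<gamma>\<^sub>2)"
    "t\<^sub>1 = rf_const (hom_eval d q \<gamma>\<^sub>1)" "t\<^sub>2 = rf_const (hom_eval d q \<gamma>\<^sub>2)"
  define x\<^sub>1 x\<^sub>2 y\<^sub>1 y\<^sub>2 where xy: "x\<^sub>1 = rf_const (proj_x \<gamma>\<^sub>1)" "x\<^sub>2 = rf_const (proj_x \<gamma>\<^sub>2)"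
    "y\<^sub>1 = rf_const (proj_y \<gamma>\<^sub>1)" "y\<^sub>2 = rf_const (proj_y \<gamma>\<^sub>2)"
  define a\<^sub>1 a\<^sub>2 r where a: "a\<^sub>1 = rf_const fiber_lc\<^sub>1" "a\<^sub>2 = rf_const fiber_lc\<^sub>2" "r = rf_const \<kappa>"
  note defs = st xy a
  have nz: "Q \<noteq> 0" "l\<^sub>1 \<noteq> 0" "l\<^sub>2 \<noteq> 0" "r \<noteq> 0"
    using den_nz assms(2) by (simp_all add: Q_def l\<^sub>1_def l\<^sub>2_def a linear_form_nz)
  have fib: "to_fract (fiber_poly d p q \<gamma>)
      = rf_const (hom_eval d q \<gamma>) * P - rf_const (hom_eval d p \<gamma>) * Q" for \<gamma>
  proof -
    have "fiber_poly d p q \<gamma> = [:hom_eval d q \<gamma>:] * p - [:hom_eval d p \<gamma>:] * q"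
      by (simp add: fiber_poly_def)
    then show ?thesis
      by (simp only: to_fract_diff to_fract_mult to_fract_const P_def Q_def)
  qed
  have pow: "to_fract (fiber_poly d p q \<gamma>) =
      rf_const (lead_coeff (fiber_poly d p q \<gamma>)) * to_fract (linear_form \<gamma>) ^ d"
    if "ram_index \<phi> \<gamma> = d" for \<gamma>
  proof -
    have "fiber_poly d p q \<gamma> = [:lead_coeff (fiber_poly d p q \<gamma>):] * linear_form \<gamma> ^ d"
      using fiber_poly_eq_power[OF that] by simp
    then show ?thesis
      by (metis to_fract_const to_fract_mult to_fract_power)
  qed
  have U: "t\<^sub>1 * P - s\<^sub>1 * Q = a\<^sub>1 * l\<^sub>1 ^ d" "t\<^sub>2 * P - s\<^sub>2 * Q = a\<^sub>2 * l\<^sub>2 ^ d"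
    using pow[OF total(1)] pow[OF total(2)] unfolding fib
    by (simp_all add: defs fiber_lc\<^sub>1_def fiber_lc\<^sub>2_def l\<^sub>1_def l\<^sub>2_def)
  define \<Delta> where "\<Delta> = s\<^sub>1 * t\<^sub>2 - s\<^sub>2 * t\<^sub>1"
  have "\<Delta> = rf_const (hom_eval d p \<gamma>\<^sub>1 * hom_eval d q \<gamma>\<^sub>2 - hom_eval d p \<gamma>\<^sub>2 * hom_eval d q \<gamma>\<^sub>1)"
    by (simp add: \<Delta>_def defs)
  then have "\<Delta> \<noteq> 0"
    using values_det by (simp del: rf_const_hom)
  have PQ: "\<Delta> * P = s\<^sub>1 * (a\<^sub>2 * l\<^sub>2 ^ d) - s\<^sub>2 * (a\<^sub>1 * l\<^sub>1 ^ d)"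
           "\<Delta> * Q = t\<^sub>1 * (a\<^sub>2 * l\<^sub>2 ^ d) - t\<^sub>2 * (a\<^sub>1 * l\<^sub>1 ^ d)"
    unfolding U[symmetric] \<Delta>_def by algebra+
  have l: "l\<^sub>1 = y\<^sub>1 * rf_z - x\<^sub>1" "l\<^sub>2 = y\<^sub>2 * rf_z - x\<^sub>2"
    by (simp_all add: l\<^sub>1_def l\<^sub>2_def linear_form_eq to_fract_linear defs)
  have \<mu>: "?\<mu> = r * l\<^sub>1 / l\<^sub>2"
    by (simp add: coord_mobius_def mobius_def l defs algebra_simps)
  have "rf_comp ?\<mu> \<phi> = mobius (\<kappa> * proj_y \<gamma>\<^sub>1) (- \<kappa> * proj_x \<gamma>\<^sub>1) (proj_y \<gamma>\<^sub>2) (- proj_x \<gamma>\<^sub>2) \<phi>"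
    by (simp add: coord_mobius_def rf_comp_mobius[OF nonconst_\<phi>] rf_comp_z[OF nonconst_\<phi>])
  also have "\<dots> = r * (y\<^sub>1 * (P / Q) - x\<^sub>1) / (y\<^sub>2 * (P / Q) - x\<^sub>2)"
    by (simp add: mobius_def Fract_conv_to_fract P_def Q_def defs algebra_simps)
  also have "\<dots> = (\<Delta> * (r * (y\<^sub>1 * P - x\<^sub>1 * Q))) / (\<Delta> * (y\<^sub>2 * P - x\<^sub>2 * Q))"
  proof -
    have "y * (P / Q) - x = (y * P - x * Q) / Q" for x y
      using nz(1) by (simp add: diff_divide_distrib)
    then show ?thesis
      using nz(1) \<open>\<Delta> \<noteq> 0\<close> by simp
  qed
  also have "\<dots> = (r * (y\<^sub>1 * (\<Delta> * P) - x\<^sub>1 * (\<Delta> * Q))) / (y\<^sub>2 * (\<Delta> * P) - x\<^sub>2 * (\<Delta> * Q))"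
    by (simp add: algebra_simps)
  also have "\<dots> = (r * ((y\<^sub>1 * s\<^sub>1 - x\<^sub>1 * t\<^sub>1) * a\<^sub>2 * l\<^sub>2 ^ d - (y\<^sub>1 * s\<^sub>2 - x\<^sub>1 * t\<^sub>2) * a\<^sub>1 * l\<^sub>1 ^ d))
      / ((y\<^sub>2 * s\<^sub>1 - x\<^sub>2 * t\<^sub>1) * a\<^sub>2 * l\<^sub>2 ^ d - (y\<^sub>2 * s\<^sub>2 - x\<^sub>2 * t\<^sub>2) * a\<^sub>1 * l\<^sub>1 ^ d)"
    unfolding PQ by (simp add: algebra_simps)
  also have "l\<^sub>1 ^ d = l\<^sub>2 ^ d * (?\<mu> ^ d / r ^ d)"
    using nz by (simp add: \<mu> power_divide power_mult_distrib)
  also have "r * ((y\<^sub>1 * s\<^sub>1 - x\<^sub>1 * t\<^sub>1) * a\<^sub>2 * l\<^sub>2 ^ d - (y\<^sub>1 * s\<^sub>2 - x\<^sub>1 * t\<^sub>2) * a\<^sub>1 * (l\<^sub>2 ^ d * (?\<mu> ^ d / r ^ d)))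
      = (- (l\<^sub>2 ^ d) / r ^ d) * (r * a\<^sub>1 * (y\<^sub>1 * s\<^sub>2 - x\<^sub>1 * t\<^sub>2) * ?\<mu> ^ d - r * r ^ d * a\<^sub>2 * (y\<^sub>1 * s\<^sub>1 - x\<^sub>1 * t\<^sub>1))"
    using nz(4) by (simp add: field_simps)
  also have "(y\<^sub>2 * s\<^sub>1 - x\<^sub>2 * t\<^sub>1) * a\<^sub>2 * l\<^sub>2 ^ d - (y\<^sub>2 * s\<^sub>2 - x\<^sub>2 * t\<^sub>2) * a\<^sub>1 * (l\<^sub>2 ^ d * (?\<mu> ^ d / r ^ d))
      = (- (l\<^sub>2 ^ d) / r ^ d) * (a\<^sub>1 * (y\<^sub>2 * s\<^sub>2 - x\<^sub>2 * t\<^sub>2) * ?\<mu> ^ d - r ^ d * a\<^sub>2 * (y\<^sub>2 * s\<^sub>1 - x\<^sub>2 * t\<^sub>1))"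
    using nz(4) by (simp add: field_simps)
  also have "(- (l\<^sub>2 ^ d) / r ^ d) * (r * a\<^sub>1 * (y\<^sub>1 * s\<^sub>2 - x\<^sub>1 * t\<^sub>2) * ?\<mu> ^ d - r * r ^ d * a\<^sub>2 * (y\<^sub>1 * s\<^sub>1 - x\<^sub>1 * t\<^sub>1))
      / ((- (l\<^sub>2 ^ d) / r ^ d) * (a\<^sub>1 * (y\<^sub>2 * s\<^sub>2 - x\<^sub>2 * t\<^sub>2) * ?\<mu> ^ d - r ^ d * a\<^sub>2 * (y\<^sub>2 * s\<^sub>1 - x\<^sub>2 * t\<^sub>1)))
      = (r * a\<^sub>1 * (y\<^sub>1 * s\<^sub>2 - x\<^sub>1 * t\<^sub>2) * ?\<mu> ^ d - r * r ^ d * a\<^sub>2 * (y\<^sub>1 * s\<^sub>1 - x\<^sub>1 * t\<^sub>1))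
      / (a\<^sub>1 * (y\<^sub>2 * s\<^sub>2 - x\<^sub>2 * t\<^sub>2) * ?\<mu> ^ d - r ^ d * a\<^sub>2 * (y\<^sub>2 * s\<^sub>1 - x\<^sub>2 * t\<^sub>1))"
    using nz by (intro mult_divide_mult_cancel_left) simp
  also have "\<dots> = mobius (\<kappa> * fiber_lc\<^sub>1 * incidence \<gamma>\<^sub>1 \<gamma>\<^sub>2) (- \<kappa> * \<kappa> ^ d * fiber_lc\<^sub>2 * incidence \<gamma>\<^sub>1 \<gamma>\<^sub>1)
           (fiber_lc\<^sub>1 * incidence \<gamma>\<^sub>2 \<gamma>\<^sub>2) (- (\<kappa> ^ d) * fiber_lc\<^sub>2 * incidence \<gamma>\<^sub>2 \<gamma>\<^sub>1) (?\<mu> ^ d)"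
    by (simp add: mobius_def incidence_def defs)
  finally show ?thesis
    using conjugate_by_iff[OF coord_mobius_PGL2(2)[OF assms] nonconst_\<phi>] by simp
qed

lemma fixed_normal_form:
  assumes "rf_eval \<phi> \<gamma>\<^sub>1 = \<gamma>\<^sub>1" "rf_eval \<phi> \<gamma>\<^sub>2 = \<gamma>\<^sub>2"
  shows "\<exists>c\<in>L. c \<noteq> 0 \<and> conjugate_over L \<phi> (rf_const c * rf_z ^ d)"
proof -
  have one: "1 \<in> L" "(1::'a) \<noteq> 0"
    using subfield by simp_all
  note \<mu> = coord_mobius_PGL2[OF one]
  let ?c = "- (fiber_lc\<^sub>1 * incidence \<gamma>\<^sub>1 \<gamma>\<^sub>2) / (fiber_lc\<^sub>2 * incidence \<gamma>\<^sub>2 \<gamma>\<^sub>1)"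
  have i: "incidence \<gamma>\<^sub>1 \<gamma>\<^sub>1 = 0" "incidence \<gamma>\<^sub>2 \<gamma>\<^sub>2 = 0" "incidence \<gamma>\<^sub>1 \<gamma>\<^sub>2 \<noteq> 0" "incidence \<gamma>\<^sub>2 \<gamma>\<^sub>1 \<noteq> 0"
    using assms distinct by (auto simp: incidence_eq_0_iff)
  have "?c \<in> L" "?c \<noteq> 0"
    using fiber_lc_props incidence_in_L i subfield by simp_all
  moreover have "conjugate_by (coord_mobius 1) \<phi> (rf_const ?c * rf_z ^ d)"
    unfolding conjugate_coord_mobius_iff[OF one] using \<mu>(3) by (simp add: mobius_def i)
  ultimately show ?thesis
    unfolding conjugate_over_def using \<mu>(1) by blast
qed

lemma swapped_normal_form:
  assumes "rf_eval \<phi> \<gamma>\<^sub>1 = \<gamma>\<^sub>2" "rf_eval \<phi> \<gamma>\<^sub>2 = \<gamma>\<^sub>1"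
  shows "\<exists>c\<in>L. c \<noteq> 0 \<and> conjugate_over L \<phi> (rf_const c / rf_z ^ d)"
proof -
  have one: "1 \<in> L" "(1::'a) \<noteq> 0"
    using subfield by simp_all
  note \<mu> = coord_mobius_PGL2[OF one]
  let ?c = "- (fiber_lc\<^sub>2 * incidence \<gamma>\<^sub>1 \<gamma>\<^sub>1) / (fiber_lc\<^sub>1 * incidence \<gamma>\<^sub>2 \<gamma>\<^sub>2)"
  have i: "incidence \<gamma>\<^sub>1 \<gamma>\<^sub>2 = 0" "incidence \<gamma>\<^sub>2 \<gamma>\<^sub>1 = 0" "incidence \<gamma>\<^sub>1 \<gamma>\<^sub>1 \<noteq> 0" "incidence \<gamma>\<^sub>2 \<gamma>\<^sub>2 \<noteq> 0"
    using assms distinct by (auto simp: incidence_eq_0_iff)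
  have "?c \<in> L" "?c \<noteq> 0"
    using fiber_lc_props incidence_in_L i subfield by simp_all
  moreover have "conjugate_by (coord_mobius 1) \<phi> (rf_const ?c / rf_z ^ d)"
    unfolding conjugate_coord_mobius_iff[OF one] using \<mu>(3) by (simp add: mobius_def i)
  ultimately show ?thesis
    unfolding conjugate_over_def using \<mu>(1) by blast
qed

text \<open>
  The hypotheses say that \<open>\<mu> \<circ> \<phi> \<circ> \<mu>\<^sup>-\<^sup>1\<close> sends infinity to a point other than \<open>0\<close> and infinity.  The scale
  \<open>\<kappa>\<close> is the one that moves this point to \<open>1\<close>.
\<close>

lemma generic_normal_form:
  assumes "rf_eval \<phi> \<gamma>\<^sub>2 \<noteq> \<gamma>\<^sub>1" "rf_eval \<phi> \<gamma>\<^sub>2 \<noteq> \<gamma>\<^sub>2"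
  shows "\<exists>a\<in>L. \<exists>b\<in>L. a \<noteq> b \<and>
           conjugate_over L \<phi> ((rf_z ^ d + rf_const a) / (rf_z ^ d + rf_const b))"
proof -
  let ?i = incidence
  have i: "?i \<gamma>\<^sub>1 \<gamma>\<^sub>2 \<noteq> 0" "?i \<gamma>\<^sub>2 \<gamma>\<^sub>2 \<noteq> 0"
    using assms by (auto simp: incidence_eq_0_iff)
  define \<kappa> where "\<kappa> = ?i \<gamma>\<^sub>2 \<gamma>\<^sub>2 / ?i \<gamma>\<^sub>1 \<gamma>\<^sub>2"
  have \<kappa>: "\<kappa> \<in> L" "\<kappa> \<noteq> 0"
    using i incidence_in_L subfield by (simp_all add: \<kappa>_def)
  note \<mu> = coord_mobius_PGL2[OF \<kappa>]
  define k where "k = fiber_lc\<^sub>1 * ?i \<gamma>\<^sub>2 \<gamma>\<^sub>2"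
  define a where "a = - \<kappa> * \<kappa> ^ d * fiber_lc\<^sub>2 * ?i \<gamma>\<^sub>1 \<gamma>\<^sub>1 / k"
  define b where "b = - (\<kappa> ^ d) * fiber_lc\<^sub>2 * ?i \<gamma>\<^sub>2 \<gamma>\<^sub>1 / k"
  have k: "k \<in> L" "k \<noteq> 0" "\<kappa> * fiber_lc\<^sub>1 * ?i \<gamma>\<^sub>1 \<gamma>\<^sub>2 = k"
    using fiber_lc_props incidence_in_L i subfield by (simp_all add: k_def \<kappa>_def)
  have "a \<in> L" "b \<in> L"
    using fiber_lc_props incidence_in_L \<kappa> k subfield by (simp_all add: a_def b_def)
  moreover have "a \<noteq> b"
  proof
    assume "a = b"
    then have "\<kappa> * ?i \<gamma>\<^sub>1 \<gamma>\<^sub>1 = ?i \<gamma>\<^sub>2 \<gamma>\<^sub>1"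
      using \<kappa> k fiber_lc_props by (simp add: a_def b_def)
    then show False
      using incidence_det i by (simp add: \<kappa>_def field_simps)
  qed
  moreover have "conjugate_by (coord_mobius \<kappa>) \<phi> ((rf_z ^ d + rf_const a) / (rf_z ^ d + rf_const b))"
  proof -
    let ?u = "coord_mobius \<kappa> ^ d"
    have ab: "rf_const (- \<kappa> * \<kappa> ^ d * fiber_lc\<^sub>2 * ?i \<gamma>\<^sub>1 \<gamma>\<^sub>1) = rf_const k * rf_const a"
             "rf_const (- (\<kappa> ^ d) * fiber_lc\<^sub>2 * ?i \<gamma>\<^sub>2 \<gamma>\<^sub>1) = rf_const k * rf_const b"
      using k(2) by (simp_all add: a_def b_def flip: rf_const_hom)
    have "mobius (\<kappa> * fiber_lc\<^sub>1 * ?i \<gamma>\<^sub>1 \<gamma>\<^sub>2) (- \<kappa> * \<kappa> ^ d * fiber_lc\<^sub>2 * ?i \<gamma>\<^sub>1 \<gamma>\<^sub>1)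
           (fiber_lc\<^sub>1 * ?i \<gamma>\<^sub>2 \<gamma>\<^sub>2) (- (\<kappa> ^ d) * fiber_lc\<^sub>2 * ?i \<gamma>\<^sub>2 \<gamma>\<^sub>1) ?u
        = (rf_const k * (?u + rf_const a)) / (rf_const k * (?u + rf_const b))"
      unfolding mobius_def k(3) ab k_def[symmetric] by (simp add: distrib_left)
    then show ?thesis
      unfolding conjugate_coord_mobius_iff[OF \<kappa>] using \<mu>(3) k(2) by simp
  qed
  ultimately show ?thesis
    unfolding conjugate_over_def using \<mu>(1) by blast
qed

end

section \<open>Conjugacies between normal forms\<close>

lemma binomial_double_root:
  fixes m n r :: "'a::field"
  assumes "[:- r, 1:] ^ 2 dvd monom m d + [:n:]" "monom m d + [:n:] \<noteq> 0"
    and "d \<ge> 2" "of_nat d \<noteq> (0 :: 'a)"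
  shows "r = 0"
proof -
  let ?X = "monom m d + [:n:]"
  obtain k where k: "?X = [:- r, 1:] ^ 2 * k"
    using assms(1) by (elim dvdE)
  have "poly ?X r = 0" "poly (pderiv ?X) r = 0"
    unfolding k by (simp_all only: power2_eq_square pderiv_mult poly_mult poly_add) simp_all
  then have root: "m * r ^ d + n = 0" "of_nat d * m * r ^ (d - 1) = 0"
    by (simp_all add: poly_monom pderiv_add pderiv_monom)
  have "m \<noteq> 0"
    using assms(2) root(1) by auto
  then show "r = 0"
    using root(2) assms(4) by simp
qed

text \<open>
  The root \<open>r\<close> of \<open>\<delta> + \<gamma> z\<close> is not a root of \<open>\<beta> + \<alpha> z\<close>, so \<open>(z - r)\<^sup>d\<close> divides \<open>m z\<^sup>d + n\<close>; as \<open>d \<ge> 2\<close>,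
  only \<open>r = 0\<close> can be such a multiple root.
\<close>

lemma linear_power_pole:
  fixes \<alpha> \<beta> \<gamma> \<delta> m n :: "'a::field"
  assumes eq: "[:\<beta>, \<alpha>:] ^ d * (monom m d + [:n:]) = [:\<delta>, \<gamma>:] ^ d * Y"
    and nz: "monom m d + [:n:] \<noteq> 0" and det: "\<alpha> * \<delta> - \<beta> * \<gamma> \<noteq> 0"
    and d: "d \<ge> 2" "of_nat d \<noteq> (0 :: 'a)"
  shows "\<gamma> = 0 \<or> \<delta> = 0"
proof (cases "\<gamma> = 0")
  case \<gamma>: False
  define r where "r = - \<delta> / \<gamma>"
  let ?N = "[:\<beta>, \<alpha>:]" and ?l = "[:- r, 1:]"
  have N: "poly ?N r \<noteq> 0"
    using det \<gamma> by (simp add: r_def field_simps)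
  then have N_nz: "?N ^ d \<noteq> 0"
    by auto
  have "[:\<delta>, \<gamma>:] = smult \<gamma> ?l"
    using \<gamma> by (simp add: r_def)
  then have "?l ^ d dvd ?N ^ d * (monom m d + [:n:])"
    unfolding eq by (metis dvd_mult2 dvd_refl dvd_smult smult_power)
  then have "d \<le> order r (?N ^ d * (monom m d + [:n:]))"
    using N_nz nz unfolding order_divides by (metis mult_eq_0_iff)
  also have "\<dots> = order r (monom m d + [:n:])"
    using N N_nz nz by (subst order_mult) (simp_all add: order_0I)
  finally have "?l ^ 2 dvd monom m d + [:n:]"
    using d(1) by (simp add: order_divides)
  then have "r = 0"
    using nz d by (rule binomial_double_root)
  then show ?thesis
    using \<gamma> by (simp add: r_def)
qed simp

lemma quadratic_at_nonconst:
  fixes u :: "'a::alg_closed_field ratfun"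
  assumes "nonconst u" "rf_const A * u\<^sup>2 + rf_const B * u + rf_const C = 0"
  shows "A = 0" "B = 0" "C = 0"
proof -
  have "rf_ev u [:C, B, A:] = 0"
    using assms(2) by (simp add: algebra_simps power2_eq_square)
  then show "A = 0" "B = 0" "C = 0"
    using rf_ev_eq_0_iff[OF assms(1), of "[:C, B, A:]"] by simp_all
qed

text \<open>
  After clearing denominators in \<open>g \<circ> \<mu> = \<mu> \<circ> f\<close> and collecting the terms with \<open>N\<^sup>d\<close> and \<open>D\<^sup>d\<close>, the lemma
  \<open>linear_power_pole\<close> applies to the pole of \<open>\<mu>\<close> and, with the roles exchanged, to its zero.
\<close>

lemma conjugacy_monomial:
  fixes a b a\<^sub>1 b\<^sub>1 :: "'a::alg_closed_field"
  assumes d: "d \<ge> 2" "of_nat d \<noteq> (0 :: 'a)" and ab: "a \<noteq> b" "a\<^sub>1 \<noteq> b\<^sub>1"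
    and det: "\<alpha> * \<delta> - \<beta> * \<gamma> \<noteq> 0"
    and eq: "mobius 1 a\<^sub>1 1 b\<^sub>1 (mobius \<alpha> \<beta> \<gamma> \<delta> rf_z ^ d) = mobius \<alpha> \<beta> \<gamma> \<delta> (mobius 1 a 1 b (rf_z ^ d))"
  shows "\<beta> = 0 \<and> \<gamma> = 0 \<or> \<alpha> = 0 \<and> \<delta> = 0"
proof -
  define N D where "N = [:\<beta>, \<alpha>:]" and "D = [:\<delta>, \<gamma>:]"
  define e\<^sub>1 e\<^sub>0 c\<^sub>1 c\<^sub>0 where "e\<^sub>1 = \<alpha> + \<beta>" "e\<^sub>0 = \<alpha> * a + \<beta> * b" "c\<^sub>1 = \<gamma> + \<delta>" "c\<^sub>0 = \<gamma> * a + \<delta> * b"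
  note ec = this
  have "e\<^sub>1 * c\<^sub>0 - e\<^sub>0 * c\<^sub>1 = (\<alpha> * \<delta> - \<beta> * \<gamma>) * (b - a)"
    unfolding ec by algebra
  then have det': "e\<^sub>1 * c\<^sub>0 - e\<^sub>0 * c\<^sub>1 \<noteq> 0"
    using det ab(1) by simp
  let ?u = "rf_z ^ d :: 'a ratfun" and ?\<mu> = "mobius \<alpha> \<beta> \<gamma> \<delta> rf_z"
  have u: "nonconst ?u"
    using d(1) by (intro nonconst_power[OF nonconst_z]) simp
  have \<mu>: "?\<mu> = to_fract N / to_fract D"
    by (simp add: mobius_def N_def D_def to_fract_linear)
  have D: "to_fract D \<noteq> 0"
    using det by (auto simp: D_def)
  have "nonconst (?\<mu> ^ d)"
    using nonconst_power[OF nonconst_mobius[OF nonconst_z det]] d(1) by simp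
  then have den: "?\<mu> ^ d + rf_const b\<^sub>1 \<noteq> 0"
    using linear_at_neq_0[of "?\<mu> ^ d" 1 b\<^sub>1] by simp
  have ub: "?u + rf_const b \<noteq> 0"
    using linear_at_neq_0[OF u, of 1 b] by simp
  have cu: "rf_const c\<^sub>1 * ?u + rf_const c\<^sub>0 \<noteq> 0"
    using det' by (intro linear_at_neq_0[OF u]) auto
  have aff: "rf_const x * (?\<mu> ^ d) + rf_const y = (rf_const x * to_fract N ^ d + rf_const y * to_fract D ^ d) / to_fract D ^ d"
    for x y
    using D by (simp add: \<mu> power_divide field_simps)
  have "mobius 1 a\<^sub>1 1 b\<^sub>1 (?\<mu> ^ d) = (to_fract N ^ d + rf_const a\<^sub>1 * to_fract D ^ d) / (to_fract N ^ d + rf_const b\<^sub>1 * to_fract D ^ d)"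
    unfolding mobius_def[of 1 a\<^sub>1] aff using D by simp
  moreover have "mobius \<alpha> \<beta> \<gamma> \<delta> (mobius 1 a 1 b ?u) = (rf_const e\<^sub>1 * ?u + rf_const e\<^sub>0) / (rf_const c\<^sub>1 * ?u + rf_const c\<^sub>0)"
  proof -
    have "rf_const x * ((?u + rf_const a) / (?u + rf_const b)) + rf_const y
      = (rf_const (x + y) * ?u + rf_const (x * a + y * b)) / (?u + rf_const b)" for x y
      using ub by (simp add: field_simps)
    then show ?thesis
      unfolding mobius_def[of \<alpha>] ec using ub by (simp add: mobius_def[of 1] del: rf_const_hom(3,6))
  qed
  moreover have "to_fract N ^ d + rf_const b\<^sub>1 * to_fract D ^ d \<noteq> 0"
    using den aff[of 1 b\<^sub>1] D by auto
  ultimately have "(to_fract N ^ d + rf_const a\<^sub>1 * to_fract D ^ d) * (rf_const c\<^sub>1 * ?u + rf_const c\<^sub>0)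
      = (rf_const e\<^sub>1 * ?u + rf_const e\<^sub>0) * (to_fract N ^ d + rf_const b\<^sub>1 * to_fract D ^ d)"
    using eq cu by (simp add: frac_eq_eq)
  then have "to_fract ((N ^ d + smult a\<^sub>1 (D ^ d)) * (monom c\<^sub>1 d + [:c\<^sub>0:]))
      = to_fract ((monom e\<^sub>1 d + [:e\<^sub>0:]) * (N ^ d + smult b\<^sub>1 (D ^ d)))"
    by (simp only: to_fract_mult to_fract_add to_fract_power to_fract_smult to_fract_monom to_fract_const)
  then have poly_eq: "(N ^ d + smult a\<^sub>1 (D ^ d)) * (monom c\<^sub>1 d + [:c\<^sub>0:])
      = (monom e\<^sub>1 d + [:e\<^sub>0:]) * (N ^ d + smult b\<^sub>1 (D ^ d))"
    by (simp only: to_fract_eq_iff)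
  define X where "X = monom (c\<^sub>1 - e\<^sub>1) d + [:c\<^sub>0 - e\<^sub>0:]"
  define Y where "Y = monom (b\<^sub>1 * e\<^sub>1 - a\<^sub>1 * c\<^sub>1) d + [:b\<^sub>1 * e\<^sub>0 - a\<^sub>1 * c\<^sub>0:]"
  have X: "X = (monom c\<^sub>1 d + [:c\<^sub>0:]) - (monom e\<^sub>1 d + [:e\<^sub>0:])"
    by (simp add: X_def diff_monom[symmetric])
  have Y: "Y = smult b\<^sub>1 (monom e\<^sub>1 d + [:e\<^sub>0:]) - smult a\<^sub>1 (monom c\<^sub>1 d + [:c\<^sub>0:])"
    by (simp add: Y_def diff_monom[symmetric] smult_add_right smult_monom)
  have NX: "N ^ d * X = D ^ d * Y"
    using poly_eq unfolding X Y by (simp add: algebra_simps smult_add_right)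
  have binom_0: "x = 0 \<and> y = 0" if "monom x d + [:y:] = 0" for x y :: 'a
  proof -
    have "coeff (monom x d + [:y:]) d = 0" "coeff (monom x d + [:y:]) 0 = 0"
      using that by simp_all
    then show ?thesis
      using d(1) by (auto simp: coeff_pCons split: nat.splits)
  qed
  \<comment> \<open>If \<open>X\<close> vanished, the fractional linear map with coefficients \<open>e\<^sub>1, e\<^sub>0, c\<^sub>1, c\<^sub>0\<close> would be
    constantly \<open>1\<close>, against its nonzero determinant.\<close>
  have X_nz: "X \<noteq> 0"
  proof
    assume "X = 0"
    then have "c\<^sub>1 = e\<^sub>1" "c\<^sub>0 = e\<^sub>0"
      using binom_0[of "c\<^sub>1 - e\<^sub>1" "c\<^sub>0 - e\<^sub>0"] unfolding X_def by simp_all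
    then show False
      using det' by simp
  qed
  moreover have "N \<noteq> 0"
    using det by (auto simp: N_def)
  ultimately have Y_nz: "Y \<noteq> 0"
    using NX by auto
  have "\<gamma> = 0 \<or> \<delta> = 0"
    using NX X_nz det d unfolding N_def D_def X_def by (rule linear_power_pole)
  moreover have "\<alpha> = 0 \<or> \<beta> = 0"
  proof (rule linear_power_pole)
    show "[:\<delta>, \<gamma>:] ^ d * (monom (b\<^sub>1 * e\<^sub>1 - a\<^sub>1 * c\<^sub>1) d + [:b\<^sub>1 * e\<^sub>0 - a\<^sub>1 * c\<^sub>0:]) = [:\<beta>, \<alpha>:] ^ d * X"
      using NX unfolding N_def D_def Y_def by simp
    show "\<gamma> * \<beta> - \<delta> * \<alpha> \<noteq> 0"
      using det by (simp add: mult.commute)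
  qed (use Y_nz d in \<open>simp_all add: Y_def\<close>)
  ultimately show ?thesis
    using det by auto
qed

text \<open>
  For \<open>\<mu> = t z\<close> the value at infinity, which is \<open>1\<close> for both maps, gives \<open>t = 1\<close>.  For \<open>\<mu> = t / z\<close>
  both sides of \<open>g \<circ> \<mu> = \<mu> \<circ> f\<close> are fractional linear in \<open>u = z\<^sup>d\<close>, and the three coefficients of the
  resulting quadratic relation in \<open>u\<close> give \<open>a\<^sub>1 = t b\<^sub>1\<close>, \<open>a = t b\<close>, and, after division by \<open>1 - t\<close>,
  the value of \<open>b\<^sub>1\<close>.
\<close>

lemma conjugacy_between_normal_forms:
  fixes a b a\<^sub>1 b\<^sub>1 :: "'a::alg_closed_field"
  assumes d: "d \<ge> 2" "of_nat d \<noteq> (0 :: 'a)" and ab: "a \<noteq> b" "a\<^sub>1 \<noteq> b\<^sub>1"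
    and \<mu>: "\<mu> \<in> PGL2 UNIV"
    and conj: "conjugate_by \<mu> ((rf_z ^ d + rf_const a) / (rf_z ^ d + rf_const b))
                       ((rf_z ^ d + rf_const a\<^sub>1) / (rf_z ^ d + rf_const b\<^sub>1))"
  shows "\<mu> = rf_z \<or>
        (a \<noteq> 0 \<and> b \<noteq> 0 \<and> \<mu> = rf_const (a / b) / rf_z \<and>
         a\<^sub>1 = a ^ d / b ^ (d + 1) \<and> b\<^sub>1 = a ^ (d - 1) / b ^ d)"
proof -
  let ?u = "rf_z ^ d :: 'a ratfun"
  have u: "nonconst ?u"
    using d(1) by (intro nonconst_power[OF nonconst_z]) simp
  have z: "(rf_z :: 'a ratfun) \<noteq> 0"
    by (simp add: rf_z_def)
  have nf: "(?u + rf_const x) / (?u + rf_const y) = mobius 1 x 1 y ?u" for x y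
    by (simp add: mobius_def)
  obtain \<alpha> \<beta> \<gamma> \<delta> where det: "\<alpha> * \<delta> - \<beta> * \<gamma> \<noteq> 0" and \<mu>_eq: "\<mu> = mobius \<alpha> \<beta> \<gamma> \<delta> rf_z"
    using \<mu> by (auto simp: PGL2_iff)
  have nc\<mu>: "nonconst \<mu>"
    using nonconst_mobius[OF nonconst_z det] by (simp add: \<mu>_eq)
  have ncf: "nonconst (mobius 1 a 1 b ?u)"
    using ab(1) by (intro nonconst_mobius[OF u]) simp
  have eq: "mobius 1 a\<^sub>1 1 b\<^sub>1 (\<mu> ^ d) = mobius \<alpha> \<beta> \<gamma> \<delta> (mobius 1 a 1 b ?u)"
    using conj unfolding nf conjugate_by_iff[OF \<mu> ncf]
    by (simp add: rf_comp_mobius nc\<mu>) (simp add: \<mu>_eq rf_comp_mobius ncf)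
  have ub: "?u + rf_const x \<noteq> 0" for x
    using linear_at_neq_0[OF u, of 1 x] by simp
  have "\<beta> = 0 \<and> \<gamma> = 0 \<or> \<alpha> = 0 \<and> \<delta> = 0"
    using conjugacy_monomial[OF d ab det] eq unfolding \<mu>_eq by blast
  then show ?thesis
  proof
    assume mon: "\<beta> = 0 \<and> \<gamma> = 0"
    define t where "t = \<alpha> / \<delta>"
    have t: "t \<noteq> 0"
      using det mon by (auto simp: t_def)
    have \<mu>t: "\<mu> = rf_const t * rf_z"
      using mon by (simp add: \<mu>_eq mobius_def t_def)
    have den: "rf_const (t ^ d) * ?u + rf_const b\<^sub>1 \<noteq> 0"
      using linear_at_neq_0[OF u, of "t ^ d" b\<^sub>1] t by simp
    have "(rf_const (t ^ d) * ?u + rf_const a\<^sub>1) / (rf_const (t ^ d) * ?u + rf_const b\<^sub>1)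
        = rf_const t * (?u + rf_const a) / (?u + rf_const b)"
    proof -
      have "mobius 1 a\<^sub>1 1 b\<^sub>1 (\<mu> ^ d) = (rf_const (t ^ d) * ?u + rf_const a\<^sub>1) / (rf_const (t ^ d) * ?u + rf_const b\<^sub>1)"
        by (simp add: mobius_def \<mu>t power_mult_distrib)
      moreover have "mobius \<alpha> \<beta> \<gamma> \<delta> (mobius 1 a 1 b ?u) = rf_const t * (?u + rf_const a) / (?u + rf_const b)"
        using mon by (simp add: mobius_def t_def mult.commute)
      ultimately show ?thesis
        using eq by simp
    qed
    then have "(rf_const (t ^ d) * ?u + rf_const a\<^sub>1) * (?u + rf_const b)
        = rf_const t * (?u + rf_const a) * (rf_const (t ^ d) * ?u + rf_const b\<^sub>1)"
      using den ub by (simp add: frac_eq_eq)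
    then have "rf_const (t ^ d - t * t ^ d) * ?u\<^sup>2
        + rf_const (t ^ d * b + a\<^sub>1 - t * b\<^sub>1 - t * a * t ^ d) * ?u + rf_const (a\<^sub>1 * b - t * a * b\<^sub>1) = 0"
      by (simp add: algebra_simps power2_eq_square)
    then have "t ^ d - t * t ^ d = 0"
      by (rule quadratic_at_nonconst(1)[OF u])
    then have "t = 1"
      using t by simp
    then show ?thesis
      using \<mu>t by simp
  next
    assume mon: "\<alpha> = 0 \<and> \<delta> = 0"
    define t where "t = \<beta> / \<gamma>"
    have t: "t \<noteq> 0"
      using det mon by (auto simp: t_def)
    have \<mu>t: "\<mu> = rf_const t / rf_z"
      using mon by (simp add: \<mu>_eq mobius_def t_def)
    have den: "rf_const b\<^sub>1 * ?u + rf_const (t ^ d) \<noteq> 0"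
      using linear_at_neq_0[OF u, of b\<^sub>1 "t ^ d"] t by simp
    have "\<mu> ^ d + rf_const x = (rf_const x * ?u + rf_const (t ^ d)) / ?u" for x
      using z by (simp add: \<mu>t power_divide field_simps)
    then have "mobius 1 a\<^sub>1 1 b\<^sub>1 (\<mu> ^ d)
        = (rf_const a\<^sub>1 * ?u + rf_const (t ^ d)) / (rf_const b\<^sub>1 * ?u + rf_const (t ^ d))"
      using z by (simp add: mobius_def)
    moreover have "mobius \<alpha> \<beta> \<gamma> \<delta> (mobius 1 a 1 b ?u) = rf_const t * (?u + rf_const b) / (?u + rf_const a)"
      using mon by (simp add: mobius_def t_def)
    ultimately have "(rf_const a\<^sub>1 * ?u + rf_const (t ^ d)) / (rf_const b\<^sub>1 * ?u + rf_const (t ^ d))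
        = rf_const t * (?u + rf_const b) / (?u + rf_const a)"
      using eq by simp
    then have "(rf_const a\<^sub>1 * ?u + rf_const (t ^ d)) * (?u + rf_const a)
        = rf_const t * (?u + rf_const b) * (rf_const b\<^sub>1 * ?u + rf_const (t ^ d))"
      using den ub by (simp add: frac_eq_eq)
    then have "rf_const (a\<^sub>1 - t * b\<^sub>1) * ?u\<^sup>2
        + rf_const (a\<^sub>1 * a + t ^ d - t * t ^ d - t * b * b\<^sub>1) * ?u + rf_const (t ^ d * a - t * b * t ^ d) = 0"
      by (simp add: algebra_simps power2_eq_square)
    note coeffs = quadratic_at_nonconst[OF u this]
    have a1: "a\<^sub>1 = t * b\<^sub>1" and a: "a = t * b"
      using coeffs(1,3) t by simp_all
    have b: "b \<noteq> 0" and "t \<noteq> 1"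
      using ab(1) a by auto
    have "(1 - t) * t ^ d = (1 - t) * (t * b * b\<^sub>1)"
      using coeffs(2) unfolding a1 a by (simp add: algebra_simps)
    then have "t ^ d = t * (b * b\<^sub>1)"
      using \<open>t \<noteq> 1\<close> by simp
    moreover have "t ^ d = t * t ^ (d - 1)"
      using d(1) by (simp add: power_eq_if)
    ultimately have "b\<^sub>1 = t ^ (d - 1) / b"
      using t b by (simp add: field_simps)
    moreover have "t = a / b"
      using a b by simp
    moreover have "b ^ d = b * b ^ (d - 1)" "a ^ d = a * a ^ (d - 1)"
      using d(1) by (simp_all add: power_eq_if)
    ultimately have "b\<^sub>1 = a ^ (d - 1) / b ^ d" "a\<^sub>1 = a ^ d / b ^ (d + 1)"
      using a1 by (simp_all add: power_divide mult.commute)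
    moreover have "\<mu> = rf_const (a / b) / rf_z"
      using \<mu>t \<open>t = a / b\<close> by simp
    moreover have "a \<noteq> 0"
      unfolding a using t b by simp
    ultimately show ?thesis
      using b by blast
  qed
qed

section \<open>The classification\<close>

lemma adjoin_subfield: "is_subfield (adjoin K S)"
proof -
  have mem: "x \<in> adjoin K S \<longleftrightarrow> (\<forall>F. is_subfield F \<and> K \<subseteq> F \<and> {x. Fin x \<in> S} \<subseteq> F \<longrightarrow> x \<in> F)" for x
    unfolding adjoin_def by blast
  show ?thesis
    unfolding is_subfield_def
    by (intro conjI ballI; simp only: mem) (blast intro: subfield_closed)+
qed

lemma adjoin_contains:
  shows "K \<subseteq> adjoin K S" and "Fin x \<in> S \<Longrightarrow> x \<in> adjoin K S"
  by (auto simp: adjoin_def)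

lemma proj_coords_in_adjoin:
  assumes "\<gamma> \<in> S"
  shows "proj_x \<gamma> \<in> adjoin K S" "proj_y \<gamma> \<in> adjoin K S"
  using assms adjoin_subfield[of K S] adjoin_contains(2)[of _ S K] by (cases \<gamma>; simp)+

theorem theorem3p4:
  fixes K L :: "'a::alg_closed_field set"
    and \<phi> :: "'a ratfun"
    and \<gamma>\<^sub>1 \<gamma>\<^sub>2 :: "'a proj_line"
    and d :: nat
  assumes "is_subfield K" and "closure_algebraic_over K"
    and "\<phi> \<in> ratfuns_over K"
    and "rf_degree \<phi> = d" and "d \<ge> 2"
    and "bicritical \<phi>" and "critical_points \<phi> = {\<gamma>\<^sub>1, \<gamma>\<^sub>2}"
    and "CHAR('a) = 0 \<or> CHAR('a) > d"
    and "L = adjoin K {\<gamma>\<^sub>1, \<gamma>\<^sub>2}"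
  shows
    "(rf_eval \<phi> \<gamma>\<^sub>1 = \<gamma>\<^sub>1 \<and> rf_eval \<phi> \<gamma>\<^sub>2 = \<gamma>\<^sub>2 \<longrightarrow>
        (\<exists>c\<in>L. c \<noteq> 0 \<and> conjugate_over L \<phi> (rf_const c * rf_z ^ d))) \<and>
     (rf_eval \<phi> \<gamma>\<^sub>1 = \<gamma>\<^sub>2 \<and> rf_eval \<phi> \<gamma>\<^sub>2 = \<gamma>\<^sub>1 \<longrightarrow>
        (\<exists>c\<in>L. c \<noteq> 0 \<and> conjugate_over L \<phi> (rf_const c / rf_z ^ d))) \<and>
     (\<not> (rf_eval \<phi> \<gamma>\<^sub>1 = \<gamma>\<^sub>1 \<and> rf_eval \<phi> \<gamma>\<^sub>2 = \<gamma>\<^sub>2) \<and>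
      \<not> (rf_eval \<phi> \<gamma>\<^sub>1 = \<gamma>\<^sub>2 \<and> rf_eval \<phi> \<gamma>\<^sub>2 = \<gamma>\<^sub>1) \<longrightarrow>
        (\<exists>a\<in>L. \<exists>b\<in>L. a \<noteq> b \<and>
           conjugate_over L \<phi> ((rf_z ^ d + rf_const a) / (rf_z ^ d + rf_const b)))) \<and>
     (\<forall>a b a\<^sub>1 b\<^sub>1 :: 'a. \<forall>\<mu>\<in>PGL2 UNIV.
        a \<noteq> b \<and> a\<^sub>1 \<noteq> b\<^sub>1 \<and>
        conjugate_by \<mu> ((rf_z ^ d + rf_const a) / (rf_z ^ d + rf_const b))
                       ((rf_z ^ d + rf_const a\<^sub>1) / (rf_z ^ d + rf_const b\<^sub>1)) \<longrightarrow>
        \<mu> = rf_z \<or>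
        (a \<noteq> 0 \<and> b \<noteq> 0 \<and> \<mu> = rf_const (a / b) / rf_z \<and>
         a\<^sub>1 = a ^ d / b ^ (d + 1) \<and> b\<^sub>1 = a ^ (d - 1) / b ^ d))"
proof -
  obtain p q where pq: "p \<in> polys_over K" "q \<in> polys_over K" "q \<noteq> 0"
    and \<phi>: "\<phi> = Fraction_Field.Fract p q" and coprime: "no_common_root p q"
    using ratfuns_over_lowest_terms[OF assms(1,3)] by blast
  obtain k where "k \<noteq> 0" "rf_num \<phi> = smult k p" "rf_den \<phi> = smult k q"
    using rf_num_den_Fract[OF pq(3) coprime] \<phi> by metis
  then have d: "d = max (degree p) (degree q)"
    using assms(4) by (simp add: rf_degree_def)
  interpret lowest_form p q d
    using pq coprime d assms(5) by unfold_locales auto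
  have distinct: "\<gamma>\<^sub>1 \<noteq> \<gamma>\<^sub>2"
    using assms(6,7) by (auto simp: bicritical_def)
  have L: "is_subfield L" "K \<subseteq> L" "proj_x \<gamma>\<^sub>1 \<in> L" "proj_x \<gamma>\<^sub>2 \<in> L" "proj_y \<gamma>\<^sub>1 \<in> L" "proj_y \<gamma>\<^sub>2 \<in> L"
    unfolding assms(9) by (simp_all add: adjoin_subfield adjoin_contains proj_coords_in_adjoin)
  interpret pair: totally_ramified_pair p q d \<gamma>\<^sub>1 \<gamma>\<^sub>2 L
    using bicritical_totally_ramified[OF assms(8) assms(7)[unfolded \<phi>] distinct] L pq(1,2) distinct
    by unfold_locales (auto simp: polys_over_def simp del: ram_index.simps)
  \<comment> \<open>In the remaining case one of the two critical points is sent outside \<open>{\<gamma>\<^sub>1, \<gamma>\<^sub>2}\<close>, the critical values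
    being distinct; that point has to be moved to infinity, so the roles may have to be exchanged.\<close>
  interpret swap: totally_ramified_pair p q d \<gamma>\<^sub>2 \<gamma>\<^sub>1 L
    by (rule pair.swapped)
  have "of_nat d \<noteq> (0 :: 'a)"
    using of_nat_neq_0[OF assms(8)] assms(5) by simp
  note unique = conjugacy_between_normal_forms[OF assms(5) this]
  have "\<exists>a\<in>L. \<exists>b\<in>L. a \<noteq> b \<and>
           conjugate_over L \<phi> ((rf_z ^ d + rf_const a) / (rf_z ^ d + rf_const b))"
    if "\<not> (rf_eval \<phi> \<gamma>\<^sub>1 = \<gamma>\<^sub>1 \<and> rf_eval \<phi> \<gamma>\<^sub>2 = \<gamma>\<^sub>2)" "\<not> (rf_eval \<phi> \<gamma>\<^sub>1 = \<gamma>\<^sub>2 \<and> rf_eval \<phi> \<gamma>\<^sub>2 = \<gamma>\<^sub>1)"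
    using that pair.values_distinct pair.generic_normal_form swap.generic_normal_form unfolding \<phi> by metis
  then show ?thesis
    using pair.fixed_normal_form pair.swapped_normal_form unique unfolding \<phi> by blast
qed

end
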